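(* Consider the iterates of algorithm DP-SCC-PL described in the context, under the network, smoothness, sampling, and bounded variance/heterogeneity assumptions listed there, and with $\lambda,\rho,\varphi,\eta,\phi,\vartheta,\theta,k_0,\iota,\bar\rho,D_k$ as defined there. Suppose that the contraction constant satisfies $0\le\rho<\bar\rho=\lambda/(4\sqrt{|\mathcal R|})$, such that $\varphi,\eta,\phi\in(0,1)$. (i) If the step-size is decaying and chosen as $\alpha_k=\theta/(k+k_0)$, then for all $k\ge 0$ $$\mathbb E D_k\le(1-\phi)^kD_0+\frac{2\iota\vartheta\theta^2}{\phi}\,\frac{1}{(k+k_0)^2}.$$ (ii) If the step-size is a constant $\alpha_k\equiv\alpha$ with $0<\alpha\le\theta$, then for all $k\ge0$ $$\mathbb E D_k\le(1-\phi)^kD_0+\frac{\vartheta}{\phi}\alpha^2 .$$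
   Context: **Network.** $\mathcal G=(\mathcal V,\mathcal E)$ is a static undirected network of $m=|\mathcal V|$ agents; $\mathcal V$ is the disjoint union of the set $\mathcal R$ of reliable agents and the set $\mathcal B$ of Byzantine agents. For $i\in\mathcal R$, $\mathcal R_i$ and $\mathcal B_i$ are its sets of reliable and Byzantine neighbors (not including $i$), and $\mathcal N_i=\mathcal R_i\cup\mathcal B_i$. The weight matrix $W=[w_{ij}]\in\mathbb R^{m\times m}$ associated with $\mathcal G$ ($w_{ij}=0$ if $j\ne i$ is not a neighbor of $i$) is nonnegative and doubly stochastic, $W\mathbf 1=\mathbf 1$, $\mathbf 1^\top W=\mathbf 1^\top$, with $w_{ii}>0$ for $i\in\mathcal R$. The reliable agents form a connected undirected network $\mathcal G_{\mathcal R}=(\mathcal R,\mathcal E_{\mathcal R})$. **Problem.** Minimize $f(x)=\frac1{|\mathcal R|}\sum_{i\in\mathcal R}f_i(x)$ over $x\in\mathbb R^n$, where $f_i(x)=\mathbb E_{\xi_i\sim\mathcal D_i}f_i(x,\xi_i)$ and $\mathbb E\nabla f_i(x,\xi_i)=\nabla f_i(x)$. **Assumptions on the objectives.** (Smoothness) Each $f_i$, $i\in\mathcal R$, has an $L_i$-Lipschitz gradient, $L_i>0$, so that $f_i(y)-f_i(x)-\langle\nabla f_i(x),y-x\rangle\le\frac{L_i}{2}\|y-x\|_2^2$ for all $x,y$; $L:=\max_{i\in\mathcal R}L_i$. (Sampling) The stochastic sampling processes associated with $\{\xi_{i,k}\}_{i\in\mathcal R,k\ge0}$ ($\xi_{i,k}\sim\mathcal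 D_i$) are independent over iterations $k=0,1,2,\dots$ and over reliable agents; sampling is uniform and without replacement. (Bounded variance and heterogeneity) There are constants $\sigma,\zeta>0$ such that for all $i\in\mathcal R$ and $x\in\mathbb R^n$: $\mathbb E\|\nabla f_i(x,\xi_i)-\nabla f_i(x)\|_2^2\le\sigma^2$ and $\big\|\mathbb E\nabla f_i(x,\xi_i)-\frac1{|\mathcal R|}\sum_{j\in\mathcal R}\mathbb E\nabla f_j(x,\xi_j)\big\|_2^2\le\zeta^2$. **Self-centered clipping (SCC).** With clipping parameter $\tau_i$, $\mathrm{Clip}\{v,\tau\}=v\cdot\min\{1,\tau/\|v\|_2\}$ and $$SCC_i\{\tilde x_i^i,\{\tilde x_j^i\}_{j\in\mathcal N_i}\}=\sum_{j\in\mathcal N_i\cup\{i\}}w_{ij}\big(\tilde x_i^i+\mathrm{Clip}\{\tilde x_j^i-\tilde x_i^i,\tau_i\}\big).$$ **Algorithm DP-SCC-PL.** Given initial $x_{i,0}\in\mathbb R^n$ and step-sizes $\alpha_k>0$, at each $k\ge 0$ each reliable $i$ computes $\tilde g_i(x_{i,k})=\nabla f_i(x_{i,k},\xi_{i,k})+\tilde n_{i,k}$, where $\tilde n_{i,k}\sim N(0,\tilde\varpi_{i,k}^2\mathbf I)$ is Gaussian noise in $\mathbb R^n$ with $0<\tilde\varpi_{i,k}^2\le\varpi_i^2$; sets $\tilde x_{i,k}^i=x_{i,k}-\alpha_k\tilde g_i(x_{i,k})$; sends $\tilde x_{i,k}^j=\tilde x_{i,k}^i$ to all neighbors $j$; receives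 $\tilde x_{j,k}^i$ from all $j\in\mathcal N_i$; and sets $x_{i,k+1}=SCC_i\{\tilde x_{i,k}^i,\{\tilde x_{j,k}^i\}_{j\in\mathcal N_i}\}$. Byzantine agents send arbitrary vectors, possibly different to different neighbors. $\varpi^2:=\max_{i\in\mathcal R}\varpi_i^2$. **Virtual weight matrix and contraction constant.** $\tilde W=[\tilde w_{ij}]\in\mathbb R^{|\mathcal R|\times|\mathcal R|}$ has $\tilde w_{ii}=w_{ii}+\sum_{j\in\mathcal B_i}w_{ij}$ and $\tilde w_{ij}=w_{ij}$ for $j\ne i$. A constant $\rho\ge0$ is a contraction constant of SCC if for all $i\in\mathcal R$ $$\big\|SCC_i(\tilde x_i^i,\{\tilde x_j^i\}_{j\in\mathcal R_i\cup\mathcal B_i})-\hat x_i\big\|_2\le\rho\max_{j\in\mathcal R_i\cup\{i\}}\|\tilde x_j^i-\hat x_i\|_2,\qquad \hat x_i:=\sum_{j\in\mathcal R_i\cup\{i\}}\tilde w_{ij}\tilde x_j^i .$$ It is assumed that $\rho$ is such a constant for the SCC steps of the algorithm. **Constants.** $\lambda:=1-\|\tilde W-\frac1{|\mathcal R|}\mathbf 1\mathbf 1^\top\|_2^2$, $\varphi:=\lambda-4\rho\sqrt{|\mathcal R|}$, $\eta:=\varphi/2$, $\phi:=\varphi/(4-\varphi)$, $\vartheta:=4|\mathcal R|\big(n\varpi^2+4(\sigma^2+\zeta^2)\big)/\phi$, $\theta:=\phi/(4\sqrt3L)$, $k_0>2/\phi$, $\iota\ge(1+1/k_0)^2$, $\bar\rho:=\lambda/(4\sqrt{|\mathcal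 R|})$. **Disagreement.** $X_k=[x_{1,k},\dots,x_{|\mathcal R|,k}]^\top\in\mathbb R^{|\mathcal R|\times n}$ collects the reliable agents' variables, and $D_k:=\|X_k-\frac1{|\mathcal R|}\mathbf 1\mathbf 1^\top X_k\|_F^2$ ($\|\cdot\|_F$ Frobenius norm, $\|\cdot\|_2$ Euclidean/spectral norm). *)

theory Defs
  imports "HOL-Probability.Probability"
begin

text \<open>
  Agents live in the type \<open>'r + 'b\<close>: the reliable agents are all \<open>Inl i\<close> with \<open>i :: 'r\<close>, where \<open>'r\<close>
  is a finite type, so that \<open>CARD('r)\<close> is their number and matrices indexed by them are of type
  \<open>real^'r^'r\<close>; the Byzantine agents are \<open>Inr b\<close> with \<open>b\<close> in a finite set of type \<open>'b set\<close>, which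
  may be empty.
\<close>

definition nbrs :: "('v \<times> 'v) set \<Rightarrow> 'v \<Rightarrow> 'v set"
  where "nbrs E u = {v. (u, v) \<in> E}"

definition reliable_nbrs :: "(('r + 'b) \<times> ('r + 'b)) set \<Rightarrow> 'r \<Rightarrow> 'r set"
  where "reliable_nbrs E i = {j. Inl j \<in> nbrs E (Inl i)}"

definition byzantine_nbrs :: "(('r + 'b) \<times> ('r + 'b)) set \<Rightarrow> 'r \<Rightarrow> 'b set"
  where "byzantine_nbrs E i = {b. Inr b \<in> nbrs E (Inl i)}"

definition agents :: "'b set \<Rightarrow> ('r + 'b) set"
  where "agents Byz = UNIV <+> Byz"

locale byzantine_network =
  fixes Byz :: "'b set"
    and E :: "(('r::finite + 'b) \<times> ('r + 'b)) set"
    and w :: "'r + 'b \<Rightarrow> 'r + 'b \<Rightarrow> real"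
  assumes finite_Byz: "finite Byz"
    and edges: "E \<subseteq> agents Byz \<times> agents Byz" "sym E" "irrefl E"
    and weight_nonneg: "u \<in> agents Byz \<Longrightarrow> v \<in> agents Byz \<Longrightarrow> 0 \<le> w u v"
    and weight_zero: "u \<in> agents Byz \<Longrightarrow> v \<in> agents Byz \<Longrightarrow> v \<noteq> u \<Longrightarrow> v \<notin> nbrs E u \<Longrightarrow> w u v = 0"
    and row_sum: "u \<in> agents Byz \<Longrightarrow> (\<Sum>v\<in>agents Byz. w u v) = 1"
    and col_sum: "v \<in> agents Byz \<Longrightarrow> (\<Sum>u\<in>agents Byz. w u v) = 1"
    and self_weight_pos: "0 < w (Inl i) (Inl i)"
    and reliable_connected: "(i, j) \<in> {(i, j). j \<in> reliable_nbrs E i}\<^sup>*"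

definition virtual_weights ::
    "(('r::finite + 'b) \<times> ('r + 'b)) set \<Rightarrow> ('r + 'b \<Rightarrow> 'r + 'b \<Rightarrow> real) \<Rightarrow> real^'r^'r"
  where "virtual_weights E w =
    (\<chi> i j. if j = i then w (Inl i) (Inl i) + (\<Sum>b\<in>byzantine_nbrs E i. w (Inl i) (Inr b))
            else w (Inl i) (Inl j))"

definition averaging :: "real^'r::finite^'r"
  where "averaging = (\<chi> i j. 1 / real CARD('r))"

text \<open>The norm of \<open>real^'n^'r\<close> is the Frobenius norm.\<close>

definition disagreement :: "real^'n^'r::finite \<Rightarrow> real"
  where "disagreement X = (norm (X - averaging ** X))\<^sup>2"

text \<open>At \<open>v = 0\<close> the quotient is \<open>t / 0 = 0\<close>, and the value is \<open>0\<close> as it should be.\<close>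

definition clip :: "'a::real_normed_vector \<Rightarrow> real \<Rightarrow> 'a"
  where "clip v t = min 1 (t / norm v) *\<^sub>R v"

text \<open>In the next two definitions \<open>y u\<close> is the vector that agent \<open>i\<close> has received from agent \<open>u\<close>,
  and \<open>y (Inl i)\<close> is agent \<open>i\<close>'s own vector.\<close>

definition scc ::
    "(('r + 'b) \<times> ('r + 'b)) set \<Rightarrow> ('r + 'b \<Rightarrow> 'r + 'b \<Rightarrow> real) \<Rightarrow> real \<Rightarrow> 'r
      \<Rightarrow> ('r + 'b \<Rightarrow> real^'n) \<Rightarrow> real^'n"
  where "scc E w t i y =
    (\<Sum>u\<in>insert (Inl i) (nbrs E (Inl i)). w (Inl i) u *\<^sub>R (y (Inl i) + clip (y u - y (Inl i)) t))"

definition scc_contraction ::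
    "(('r::finite + 'b) \<times> ('r + 'b)) set \<Rightarrow> ('r + 'b \<Rightarrow> 'r + 'b \<Rightarrow> real) \<Rightarrow> real \<Rightarrow> real \<Rightarrow> 'r
      \<Rightarrow> ('r + 'b \<Rightarrow> real^'n) \<Rightarrow> bool"
  where "scc_contraction E w \<rho> t i y \<longleftrightarrow>
    (let N = insert i (reliable_nbrs E i);
         xhat = (\<Sum>j\<in>N. virtual_weights E w $ i $ j *\<^sub>R y (Inl j))
     in norm (scc E w t i y - xhat) \<le> \<rho> * Max ((\<lambda>j. norm (y (Inl j) - xhat)) ` N))"

text \<open>
  \<open>law i\<close> is the distribution of the samples of agent \<open>i\<close>, \<open>f i x s\<close> the loss at the sample \<open>s\<close>,
  \<open>g i x s\<close> its gradient in \<open>x\<close>, and \<open>G i\<close> the gradient of the expected loss. The law is an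
  arbitrary probability measure; in particular it may be the law of a batch drawn uniformly and
  without replacement from a finite data set.
\<close>

locale stochastic_objectives =
  fixes law :: "'r::finite \<Rightarrow> 's measure"
    and f :: "'r \<Rightarrow> real^'n \<Rightarrow> 's \<Rightarrow> real"
    and g :: "'r \<Rightarrow> real^'n \<Rightarrow> 's \<Rightarrow> real^'n"
    and G :: "'r \<Rightarrow> real^'n \<Rightarrow> real^'n"
    and L :: "'r \<Rightarrow> real"
    and \<sigma> \<zeta> :: real
  assumes prob_law: "prob_space (law i)"
    and integrable_loss: "integrable (law i) (f i x)"
    and sample_gradient: "s \<in> space (law i) \<Longrightarrow> GDERIV (\<lambda>y. f i y s) x :> g i x s"
    and measurable_gradient: "(\<lambda>(x, s). g i x s) \<in> borel_measurable (borel \<Otimes>\<^sub>M law i)"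
    and gradient: "GDERIV (\<lambda>y. \<integral>s. f i y s \<partial>law i) x :> G i x"
    and integrable_gradient: "integrable (law i) (g i x)"
    and unbiased: "(\<integral>s. g i x s \<partial>law i) = G i x"
    and L_pos: "0 < L i"
    and smooth: "(L i)-lipschitz_on UNIV (G i)"
    and sigma_pos: "0 < \<sigma>"
    and zeta_pos: "0 < \<zeta>"
    and integrable_variance: "integrable (law i) (\<lambda>s. (norm (g i x s - G i x))\<^sup>2)"
    and variance: "(\<integral>s. (norm (g i x s - G i x))\<^sup>2 \<partial>law i) \<le> \<sigma>\<^sup>2"
    and heterogeneity:
      "(norm ((\<integral>s. g i x s \<partial>law i) - (1 / real CARD('r)) *\<^sub>R (\<Sum>j\<in>UNIV. \<integral>s. g j x s \<partial>law j)))\<^sup>2 \<le> \<zeta>\<^sup>2"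

text \<open>The density of \<open>N(0, s\<^sup>2 I)\<close> with respect to Lebesgue measure.\<close>

definition gaussian_density :: "real \<Rightarrow> real^'n \<Rightarrow> real"
  where "gaussian_density s v = (\<Prod>l\<in>UNIV. normal_density 0 s (v $ l))"

definition half_step ::
    "('r::finite \<Rightarrow> real^'n \<Rightarrow> 's \<Rightarrow> real^'n) \<Rightarrow> real \<Rightarrow> real^'n^'r \<Rightarrow> ('r \<Rightarrow> 's) \<Rightarrow> ('r \<Rightarrow> real^'n)
      \<Rightarrow> real^'n^'r"
  where "half_step g a X s v = (\<chi> i. X $ i - a *\<^sub>R (g i (X $ i) (s i) + v i))"

text \<open>Reliable agents send row \<open>j\<close> of \<open>Y\<close> to everybody; Byzantine agent \<open>b\<close> sends \<open>m b i\<close> to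
  agent \<open>i\<close>.\<close>

definition received :: "real^'n^'r::finite \<Rightarrow> ('b \<Rightarrow> 'r \<Rightarrow> real^'n) \<Rightarrow> 'r \<Rightarrow> 'r + 'b \<Rightarrow> real^'n"
  where "received Y m i u = (case u of Inl j \<Rightarrow> Y $ j | Inr b \<Rightarrow> m b i)"

text \<open>
  Row \<open>i\<close> of \<open>X k \<omega>\<close> is the iterate of agent \<open>i\<close> and row \<open>i\<close> of \<open>Y k \<omega>\<close> is the vector it sends.
  The \<open>\<sigma>\<close>-algebra \<open>F k\<close> is the information available before iteration \<open>k\<close>. The Byzantine messages
  of iteration \<open>k\<close> are arbitrary functions of everything that has happened up to and including the
  sampling and noise of that iteration (and possibly of further randomness), but they cannot
  anticipate the samples of later iterations. The noise is subject to the same requirement only.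
  The clipping parameter may depend on the iteration and on the messages of that iteration; a
  fixed parameter for each agent is the special case of functions \<open>\<tau> i k\<close> that are constant and
  independent of \<open>k\<close>.
\<close>

locale dp_scc_pl = prob_space M
  for M :: "'w measure" +
  fixes E :: "(('r::finite + 'b) \<times> ('r + 'b)) set"
    and w :: "'r + 'b \<Rightarrow> 'r + 'b \<Rightarrow> real"
    and law :: "'r \<Rightarrow> 's measure"
    and g :: "'r \<Rightarrow> real^'n \<Rightarrow> 's \<Rightarrow> real^'n"
    and F :: "nat \<Rightarrow> 'w measure"
    and \<xi> :: "'r \<Rightarrow> nat \<Rightarrow> 'w \<Rightarrow> 's"
    and noise :: "'r \<Rightarrow> nat \<Rightarrow> 'w \<Rightarrow> real^'n"
    and noise_std :: "'r \<Rightarrow> nat \<Rightarrow> real"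
    and varpi :: "'r \<Rightarrow> real"
    and msg :: "nat \<Rightarrow> 'w \<Rightarrow> 'b \<Rightarrow> 'r \<Rightarrow> real^'n"
    and \<tau> :: "'r \<Rightarrow> nat \<Rightarrow> 'w \<Rightarrow> real"
    and \<alpha> :: "nat \<Rightarrow> real"
    and X0 :: "real^'n^'r"
    and X Y :: "nat \<Rightarrow> 'w \<Rightarrow> real^'n^'r"
  assumes filtration: "subalgebra M (F k)" "sets (F k) \<subseteq> sets (F (Suc k))"
    and sample_adapted: "\<xi> i k \<in> measurable (F (Suc k)) (law i)"
    and sample_law: "distr M (law i) (\<xi> i k) = law i"
    and samples_indep: "indep_vars (\<lambda>(i, k). law i) (\<lambda>(i, k). \<xi> i k) UNIV"
    and sample_indep_past:
      "indep_set (sets (F k)) (sets (vimage_algebra (space M) (\<xi> i k) (law i)))"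
    and noise_adapted: "noise i k \<in> borel_measurable (F (Suc k))"
    and noise_std_bounds: "0 < noise_std i k" "(noise_std i k)\<^sup>2 \<le> (varpi i)\<^sup>2"
    and noise_law: "distributed M lborel (noise i k) (gaussian_density (noise_std i k))"
    and msg_adapted: "(\<lambda>\<omega>. msg k \<omega> b i) \<in> borel_measurable (F (Suc k))"
    and clipping_adapted: "\<tau> i k \<in> borel_measurable (F (Suc k))"
    and step_size_pos: "0 < \<alpha> k"
    and init: "\<omega> \<in> space M \<Longrightarrow> X 0 \<omega> = X0"
    and local_step:
      "\<omega> \<in> space M \<Longrightarrow>
        Y k \<omega> = half_step g (\<alpha> k) (X k \<omega>) (\<lambda>i. \<xi> i k \<omega>) (\<lambda>i. noise i k \<omega>)"
    and aggregation:
      "\<omega> \<in> space M \<Longrightarrow>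
        X (Suc k) \<omega> = (\<chi> i. scc E w (\<tau> i k \<omega>) i (received (Y k \<omega>) (msg k \<omega>) i))"

end

theory Submission
  imports Defs
begin

text \<open>All estimates are made in the seminorm \<open>norm (X - J X)\<close>, where \<open>J\<close> is the averaging matrix; its
  square is the disagreement \<open>D(X)\<close>. An iteration consists of a local step \<open>X \<mapsto> Y\<close> and an
  aggregation \<open>Y \<mapsto> X'\<close>.

  Aggregation contracts, whatever the Byzantine agents send. The matrix \<open>X'\<close> is the virtual average
  \<open>W Y\<close> up to a clipping error, which is at most \<open>2 \<rho> sqrt (CARD('r))\<close> times the deviation of \<open>Y\<close>,
  since \<open>\<rho>\<close> multiplies distances from vectors sent by reliable agents to convex combinations of
  such vectors. Together with the spectral
  norm of \<open>W - J\<close> this gives \<open>D(X') \<le> (1 - vphi) D(Y)\<close> (lemma \<open>disagreement_scc_le\<close>).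

  The local step creates little disagreement. By Young's inequality with weight \<open>\<phi>\<close>, \<open>D(Y)\<close> is at
  most \<open>D(X) / (1 - \<phi>)\<close> plus \<open>\<alpha>\<^sup>2 / \<phi>\<close> times the disagreement of the noisy gradients, and the latter
  splits into noise, sampling error, drift (at most a multiple of \<open>D(X)\<close>) and heterogeneity
  (lemma \<open>disagreement_half_step_le\<close>).

  Both bounds are pointwise. Probability enters only through two second moments: that of the
  Gaussian noise, and that of the sampling error at the random iterate, which is bounded by \<open>\<sigma>\<^sup>2\<close>
  because the iterate is determined by the past and each sample is independent of the past. Taking
  expectations gives
  \<open>E D(X (k+1)) \<le> (1 - 3 \<phi> / 2) E D(X k) + vtheta / 2 * (\<alpha> k)\<^sup>2\<close> (lemma \<open>disagreement_recursion\<close>).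

  The two bounds of the theorem then follow from a comparison principle
  (lemma \<open>recursion_le_supersolution\<close>): \<open>vtheta \<alpha>\<^sup>2 / \<phi>\<close> for a constant step-size, and a multiple
  of \<open>1 / (k + k0)\<^sup>2\<close> for the decaying one, is a supersolution of this recursion.\<close>

section \<open>Frobenius norm and deviation from the average\<close>

lemma norm_vec_power2: "(norm x)\<^sup>2 = (\<Sum>i\<in>UNIV. (norm (x $ i))\<^sup>2)"
  by (simp add: norm_vec_def L2_set_def sum_nonneg)

lemma norm_vec_le_sqrt_card:
  fixes x :: "'a::real_normed_vector^'r::finite"
  assumes "\<And>i. norm (x $ i) \<le> b"
  shows "norm x \<le> sqrt (real CARD('r)) * b"
proof -
  have "0 \<le> b" using assms[of undefined] norm_ge_zero order_trans by blast
  have "(norm x)\<^sup>2 \<le> (\<Sum>i\<in>(UNIV :: 'r set). b\<^sup>2)"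
    unfolding norm_vec_power2 by (intro sum_mono power_mono assms) auto
  also have "\<dots> = (sqrt (real CARD('r)) * b)\<^sup>2"
    by (simp add: power_mult_distrib)
  finally show ?thesis
    by (rule power2_le_imp_le) (simp add: \<open>0 \<le> b\<close>)
qed

text \<open>The squared Frobenius norm is the sum of the squared norms of the columns, and a matrix acts on
  each column separately; this brings the spectral norm of the weights to bear on a matrix of
  iterates.\<close>

lemma norm_matrix_mult_le:
  fixes A :: "real^'m^'r::finite" and X :: "real^'n^'m::finite"
  shows "norm (A ** X) \<le> onorm ((*v) A) * norm X"
proof -
  have columns: "(norm Z)\<^sup>2 = (\<Sum>l\<in>UNIV. (norm (column l Z))\<^sup>2)" for Z :: "real^'n^'k::finite"
    by (simp add: norm_vec_power2 column_def) (rule sum.swap)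
  have column_mult: "column l (A ** X) = A *v column l X" for l
    by (simp add: column_def matrix_matrix_mult_def matrix_vector_mult_def vec_eq_iff)
  have "(norm (A ** X))\<^sup>2 \<le> (\<Sum>l\<in>UNIV. (onorm ((*v) A) * norm (column l X))\<^sup>2)"
    unfolding columns column_mult by (intro sum_mono power_mono onorm) auto
  also have "\<dots> = (onorm ((*v) A) * norm X)\<^sup>2"
    unfolding power_mult_distrib columns[of X] sum_distrib_left ..
  finally show ?thesis
    by (rule power2_le_imp_le) (simp add: onorm_pos_le)
qed

lemma matrix_mult_diff_distrib:
  fixes A B :: "real^'m^'r" and X Z :: "real^'n^'m::finite"
  shows matrix_diff_rdistrib: "(A - B) ** X = A ** X - B ** X"
    and matrix_diff_ldistrib: "A ** (X - Z) = A ** X - A ** Z"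
  by (simp_all add: matrix_matrix_mult_def vec_eq_iff algebra_simps sum_subtractf)

lemma averaging_mult_nth:
  fixes X :: "real^'n^'r::finite"
  shows "(averaging ** X) $ i = (1 / real CARD('r)) *\<^sub>R (\<Sum>j\<in>UNIV. X $ j)"
  by (simp add: averaging_def matrix_matrix_mult_def vec_eq_iff sum_divide_distrib)

lemma averaging_mult_idem:
  fixes X :: "real^'n^'r::finite"
  shows "averaging ** (averaging ** X) = averaging ** X"
  by (simp add: vec_eq_iff[where 'b='r] averaging_mult_nth sum_constant_scaleR
      del: sum_constant)

text \<open>Disagreement is the square of a seminorm, namely of the norm of this linear map, and the estimates
  below are triangle inequalities in that seminorm.\<close>

definition deviation :: "real^'n^'r::finite \<Rightarrow> real^'n^'r"
  where "deviation X = X - averaging ** X"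

lemma disagreement_eq: "disagreement X = (norm (deviation X))\<^sup>2"
  by (simp add: disagreement_def deviation_def)

lemma deviation_nth:
  fixes X :: "real^'n^'r::finite"
  shows "deviation X $ i = X $ i - (1 / real CARD('r)) *\<^sub>R (\<Sum>j\<in>UNIV. X $ j)"
  by (simp add: deviation_def averaging_mult_nth)

lemma deviation_add:
  fixes X Z :: "real^'n^'r::finite"
  shows "deviation (X + Z) = deviation X + deviation Z"
  by (simp add: vec_eq_iff deviation_nth sum.distrib algebra_simps add_divide_distrib)

lemma deviation_diff:
  fixes X Z :: "real^'n^'r::finite"
  shows "deviation (X - Z) = deviation X - deviation Z"
  by (simp add: vec_eq_iff deviation_nth sum_subtractf algebra_simps diff_divide_distrib)

lemma deviation_scaleR:
  fixes X :: "real^'n^'r::finite"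
  shows "deviation (a *\<^sub>R X) = a *\<^sub>R deviation X"
  by (simp add: vec_eq_iff deviation_nth algebra_simps sum_distrib_left)

lemma deviation_averaging_mult:
  fixes X :: "real^'n^'r::finite"
  shows "deviation (averaging ** X) = 0"
  by (simp add: deviation_def averaging_mult_idem)

text \<open>Deviation is the orthogonal projection away from the matrices with equal rows.\<close>

lemma norm_deviation_le:
  fixes X :: "real^'n^'r::finite"
  shows "norm (deviation X) \<le> norm X"
proof -
  have "inner (deviation X) (averaging ** X) = 0"
    by (simp add: inner_vec_def[where 'b='r] deviation_nth averaging_mult_nth inner_diff_left
        sum_subtractf flip: inner_sum_left sum_distrib_left sum_divide_distrib)
  then have "(norm (deviation X + averaging ** X))\<^sup>2
      = (norm (deviation X))\<^sup>2 + (norm (averaging ** X))\<^sup>2"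
    by (intro norm_add_Pythagorean) (simp add: orthogonal_def)
  then have "(norm (deviation X))\<^sup>2 \<le> (norm X)\<^sup>2"
    by (simp add: deviation_def)
  then show ?thesis
    by (rule power2_le_imp_le) simp
qed

lemma disagreement_le:
  fixes X :: "real^'n^'r::finite"
  shows "disagreement X \<le> (norm X)\<^sup>2"
  unfolding disagreement_eq by (intro power_mono norm_deviation_le) simp

text \<open>Since \<open>J Z\<close> has equal rows, it may serve as a reference point: agreement may be measured against
  the average of the sent vectors \<open>Z\<close> even though aggregation does not preserve that average.\<close>

lemma norm_deviation_le_dist_averaging:
  fixes X Z :: "real^'n^'r::finite"
  shows "norm (deviation X) \<le> norm (X - averaging ** Z)"
  using norm_deviation_le[of "X - averaging ** Z"]
  by (simp add: deviation_diff deviation_averaging_mult)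

lemma norm_row_diff_le:
  fixes X :: "real^'n^'r::finite"
  shows "norm (X $ i - X $ j) \<le> 2 * norm (deviation X)"
proof -
  have "X $ i - X $ j = deviation X $ i - deviation X $ j"
    by (simp add: deviation_nth)
  then have "norm (X $ i - X $ j) \<le> norm (deviation X $ i) + norm (deviation X $ j)"
    using norm_triangle_ineq4 by metis
  also have "\<dots> \<le> norm (deviation X) + norm (deviation X)"
    by (intro add_mono Finite_Cartesian_Product.norm_nth_le)
  finally show ?thesis by simp
qed

section \<open>The virtual weight matrix\<close>

lemma nbrs_subset_agents:
  fixes E :: "(('r::finite + 'b) \<times> ('r + 'b)) set"
  assumes "byzantine_network Byz E w"
  shows "nbrs E u \<subseteq> agents Byz"
proof -
  interpret byzantine_network Byz E w by fact
  show ?thesis using edges(1) by (auto simp: nbrs_def)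
qed

lemma virtual_weights_nonneg:
  fixes E :: "(('r::finite + 'b) \<times> ('r + 'b)) set"
  assumes "byzantine_network Byz E w"
  shows "0 \<le> virtual_weights E w $ i $ j"
proof -
  interpret byzantine_network Byz E w by fact
  have "Inr b \<in> (agents Byz :: ('r + 'b) set)" if "b \<in> byzantine_nbrs E i" for b
    using that subsetD[OF nbrs_subset_agents[OF assms]] by (simp add: byzantine_nbrs_def)
  moreover have "Inl l \<in> (agents Byz :: ('r + 'b) set)" for l
    by (simp add: agents_def InlI)
  ultimately show ?thesis
    by (auto simp: virtual_weights_def intro!: add_nonneg_nonneg sum_nonneg weight_nonneg)
qed

lemma virtual_weights_nonadjacent:
  fixes E :: "(('r::finite + 'b) \<times> ('r + 'b)) set"
  assumes "byzantine_network Byz E w" and "j \<notin> insert i (reliable_nbrs E i)"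
  shows "virtual_weights E w $ i $ j = 0"
proof -
  interpret byzantine_network Byz E w by fact
  show ?thesis using assms(2) weight_zero[of "Inl i" "Inl j"]
    by (auto simp: virtual_weights_def reliable_nbrs_def agents_def)
qed

text \<open>The weight of the Byzantine neighbours is moved to the diagonal, which leaves row sums alone. Column
  sums change when the weights are asymmetric, so that the virtual average need not have the same
  mean as the vectors sent.\<close>

lemma virtual_weights_row_sum:
  fixes E :: "(('r::finite + 'b) \<times> ('r + 'b)) set"
  assumes "byzantine_network Byz E w"
  shows "(\<Sum>j\<in>UNIV. virtual_weights E w $ i $ j) = 1"
proof -
  interpret byzantine_network Byz E w by fact
  have byz: "byzantine_nbrs E i \<subseteq> Byz"
    using nbrs_subset_agents[OF assms] by (auto simp: byzantine_nbrs_def agents_def)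
  have "(\<Sum>j\<in>UNIV. virtual_weights E w $ i $ j)
      = (\<Sum>j\<in>UNIV. w (Inl i) (Inl j)) + (\<Sum>b\<in>byzantine_nbrs E i. w (Inl i) (Inr b))"
    by (simp add: virtual_weights_def sum.remove[of UNIV i])
  also have "(\<Sum>b\<in>byzantine_nbrs E i. w (Inl i) (Inr b)) = (\<Sum>b\<in>Byz. w (Inl i) (Inr b))"
    using byz finite_Byz weight_zero[of "Inl i"]
    by (intro sum.mono_neutral_left) (auto simp: byzantine_nbrs_def agents_def)
  also have "(\<Sum>j\<in>UNIV. w (Inl i) (Inl j)) + \<dots> = (\<Sum>v\<in>agents Byz. w (Inl i) v)"
    using finite_Byz by (simp add: agents_def sum.Plus)
  finally show ?thesis
    using row_sum[of "Inl i"] InlI[of i UNIV Byz] by (simp add: agents_def)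
qed

section \<open>Contraction of the disagreement by clipped aggregation\<close>

lemma norm_row_minus_convex_combination_le:
  fixes Y :: "real^'n^'r::finite"
  assumes "\<And>l. 0 \<le> p l" and "(\<Sum>l\<in>UNIV. p l) = 1"
  shows "norm (Y $ j - (\<Sum>l\<in>UNIV. p l *\<^sub>R Y $ l)) \<le> 2 * norm (deviation Y)"
proof -
  have "Y $ j - (\<Sum>l\<in>UNIV. p l *\<^sub>R Y $ l) = (\<Sum>l\<in>UNIV. p l *\<^sub>R (Y $ j - Y $ l))"
    using assms(2) by (simp add: scaleR_diff_right sum_subtractf flip: scaleR_sum_left)
  also have "norm \<dots> \<le> (\<Sum>l\<in>UNIV. p l * (2 * norm (deviation Y)))"
    using assms(1) by (intro sum_norm_le) (simp add: mult_left_mono norm_row_diff_le)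
  also have "\<dots> = 2 * norm (deviation Y)"
    using assms(2) by (simp flip: sum_distrib_right)
  finally show ?thesis .
qed

text \<open>Write \<open>Z\<close> for the aggregated vectors and \<open>W\<close> for the virtual weights. Then
  \<open>Z - J Y = (W - J) (Y - J Y) + (Z - W Y)\<close>, because the rows of \<open>W\<close> sum to one and hence
  \<open>W J = J\<close>. The first term contracts by the spectral norm of \<open>W - J\<close>. In the second term, row
  \<open>i\<close> is the distance between the clipped average and the virtual average \<open>xhat\<close>; by the
  contraction property it is at most \<open>\<rho>\<close> times the distance of some sent vector from a convex
  combination of sent vectors, and any two sent vectors differ by at most twice the deviation. The
  factor \<open>sqrt (CARD('r))\<close> comes from collecting these row bounds in the Frobenius norm.\<close>

lemma norm_deviation_scc_le:
  fixes Y :: "real^'n^'r::finite"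
  assumes network: "byzantine_network Byz E w"
    and contraction: "\<And>i. scc_contraction E w \<rho> (t i) i (received Y m i)"
    and "0 \<le> \<rho>"
  shows "norm (deviation (\<chi> i. scc E w (t i) i (received Y m i)))
    \<le> (onorm ((*v) (virtual_weights E w - averaging)) + 2 * \<rho> * sqrt (real CARD('r)))
        * norm (deviation Y)"
proof -
  let ?W = "virtual_weights E w :: real^'r^'r"
  define Z where "Z = (\<chi> i. scc E w (t i) i (received Y m i))"
  have mult_nth: "(?W ** V) $ i = (\<Sum>l\<in>UNIV. ?W $ i $ l *\<^sub>R V $ l)" for V :: "real^'n^'r" and i
    by (simp add: matrix_matrix_mult_def vec_eq_iff)
  have clipping_error: "norm ((Z - ?W ** Y) $ i) \<le> \<rho> * (2 * norm (deviation Y))" for i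
  proof -
    let ?N = "insert i (reliable_nbrs E i)"
    have xhat: "(\<Sum>j\<in>?N. ?W $ i $ j *\<^sub>R received Y m i (Inl j)) = (?W ** Y) $ i"
      unfolding mult_nth received_def using virtual_weights_nonadjacent[OF network]
      by (intro sum.mono_neutral_cong_left) auto
    have "norm (Y $ j - (?W ** Y) $ i) \<le> 2 * norm (deviation Y)" for j
      unfolding mult_nth
      by (intro norm_row_minus_convex_combination_le virtual_weights_nonneg[OF network]
          virtual_weights_row_sum[OF network])
    then have "Max ((\<lambda>j. norm (received Y m i (Inl j) - (?W ** Y) $ i)) ` ?N)
        \<le> 2 * norm (deviation Y)"
      by (intro Max.boundedI) (auto simp: received_def)
    moreover have "norm (Z $ i - (?W ** Y) $ i)
        \<le> \<rho> * Max ((\<lambda>j. norm (received Y m i (Inl j) - (?W ** Y) $ i)) ` ?N)"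
      using contraction[of i] unfolding scc_contraction_def Let_def xhat Z_def by simp
    ultimately show ?thesis
      using \<open>0 \<le> \<rho>\<close> by (simp add: order_trans[OF _ mult_left_mono])
  qed
  have "(?W - averaging) ** deviation Y = ?W ** Y - averaging ** Y"
  proof -
    have "?W ** (averaging ** Y) = averaging ** Y"
      by (simp add: vec_eq_iff[where 'b='r] mult_nth averaging_mult_nth
          virtual_weights_row_sum[OF network] flip: scaleR_sum_left sum_divide_distrib)
    then show ?thesis
      by (simp add: deviation_def matrix_diff_ldistrib matrix_diff_rdistrib averaging_mult_idem)
  qed
  then have "norm (deviation Z) \<le> norm ((?W - averaging) ** deviation Y + (Z - ?W ** Y))"
    using norm_deviation_le_dist_averaging[of Z Y] by simp
  also have "\<dots> \<le> onorm ((*v) (?W - averaging)) * norm (deviation Y)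
      + sqrt (real CARD('r)) * (\<rho> * (2 * norm (deviation Y)))"
    by (intro norm_triangle_le add_mono norm_matrix_mult_le norm_vec_le_sqrt_card clipping_error)
  finally show ?thesis
    by (simp add: Z_def algebra_simps)
qed

text \<open>With \<open>s\<close> the spectral norm and \<open>r = 2 \<rho> sqrt (CARD('r))\<close>, the claim is \<open>(s + r)\<^sup>2 \<le> s\<^sup>2 + 2 r\<close>,
  that is, \<open>r (2 s + r) \<le> 2 r\<close>. The hypothesis on \<open>\<rho>\<close> says \<open>2 r \<le> 1 - s\<^sup>2\<close>, and
  \<open>2 s + (1 - s\<^sup>2) / 2 \<le> 2\<close> is \<open>(1 - s) (3 - s) \<ge> 0\<close>.\<close>

lemma disagreement_scc_le:
  fixes Y :: "real^'n^'r::finite"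
  assumes network: "byzantine_network Byz E w"
    and contraction: "\<And>i. scc_contraction E w \<rho> (t i) i (received Y m i)"
    and lam: "lam = 1 - (onorm ((*v) (virtual_weights E w - averaging)))\<^sup>2"
    and rho: "0 \<le> \<rho>" "4 * \<rho> * sqrt (real CARD('r)) \<le> lam"
  shows "disagreement (\<chi> i. scc E w (t i) i (received Y m i))
    \<le> (1 - (lam - 4 * \<rho> * sqrt (real CARD('r)))) * disagreement Y"
proof -
  define s where "s = onorm ((*v) (virtual_weights E w - averaging))"
  define r where "r = 2 * \<rho> * sqrt (real CARD('r))"
  have "0 \<le> s" by (simp add: s_def onorm_pos_le)
  have "0 \<le> r" "2 * r \<le> 1 - s\<^sup>2" using rho by (simp_all add: r_def lam s_def)
  then have "s\<^sup>2 \<le> 1\<^sup>2" by simp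
  then have "s \<le> 1" by (rule power2_le_imp_le) simp
  have "4 * s - s\<^sup>2 \<le> 3"
    using mult_nonneg_nonneg[of "1 - s" "3 - s"] \<open>s \<le> 1\<close> by (simp add: power2_eq_square algebra_simps)
  then have "2 * s + r \<le> 2" using \<open>2 * r \<le> 1 - s\<^sup>2\<close> by simp
  then have "r * (2 * s + r) \<le> r * 2" using \<open>0 \<le> r\<close> by (intro mult_left_mono)
  then have factor: "(s + r)\<^sup>2 \<le> 1 - (lam - 4 * \<rho> * sqrt (real CARD('r)))"
    by (simp add: lam r_def flip: s_def) (simp add: power2_eq_square algebra_simps)
  have "disagreement (\<chi> i. scc E w (t i) i (received Y m i)) \<le> ((s + r) * norm (deviation Y))\<^sup>2"
    unfolding disagreement_eq s_def r_def
    by (intro power_mono norm_deviation_scc_le[OF network contraction rho(1)]) simp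
  also have "\<dots> = (s + r)\<^sup>2 * disagreement Y"
    by (simp add: disagreement_eq power_mult_distrib)
  also have "\<dots> \<le> (1 - (lam - 4 * \<rho> * sqrt (real CARD('r)))) * disagreement Y"
    by (intro mult_right_mono factor) (simp add: disagreement_eq)
  finally show ?thesis .
qed

section \<open>Disagreement created by a local gradient step\<close>

lemma norm_add3_power2_le:
  fixes a b c :: "'a::real_normed_vector"
  shows "(norm (a + b + c))\<^sup>2 \<le> 3 * ((norm a)\<^sup>2 + (norm b)\<^sup>2 + (norm c)\<^sup>2)"
proof -
  have "(norm (a + b + c))\<^sup>2 \<le> (norm a + norm b + norm c)\<^sup>2"
    by (intro power_mono order_trans[OF norm_triangle_ineq] add_mono norm_triangle_ineq) auto
  also have "\<dots> \<le> 3 * ((norm a)\<^sup>2 + (norm b)\<^sup>2 + (norm c)\<^sup>2)"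
    using zero_le_power2[of "norm a - norm b"] zero_le_power2[of "norm a - norm c"]
      zero_le_power2[of "norm b - norm c"]
    by (simp add: power2_eq_square algebra_simps)
  finally show ?thesis .
qed

lemma norm_add_power2_le:
  fixes a b :: "'a::real_normed_vector"
  shows "(norm (a + b))\<^sup>2 \<le> 2 * (norm a)\<^sup>2 + 2 * (norm b)\<^sup>2"
proof -
  have "(norm (a + b))\<^sup>2 \<le> (norm a + norm b)\<^sup>2"
    by (intro power_mono norm_triangle_ineq) auto
  then show ?thesis
    using zero_le_power2[of "norm a - norm b"] by (simp add: power2_eq_square algebra_simps)
qed

text \<open>Young's inequality: the right-hand side exceeds \<open>(norm a + norm b)\<^sup>2\<close> by a multiple of the square
  of \<open>c * norm a - (1 - c) * norm b\<close>.\<close>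

lemma norm_diff_power2_le_weighted:
  fixes a b :: "'a::real_normed_vector"
  assumes "0 < c" "c < 1"
  shows "(norm (a - b))\<^sup>2 \<le> (norm a)\<^sup>2 / (1 - c) + (norm b)\<^sup>2 / c"
proof -
  have "(norm (a - b))\<^sup>2 \<le> (norm a + norm b)\<^sup>2"
    by (intro power_mono norm_triangle_ineq4) auto
  also have "\<dots> = (norm a)\<^sup>2 / (1 - c) + (norm b)\<^sup>2 / c
      - (c * norm a - (1 - c) * norm b)\<^sup>2 / (c * (1 - c))"
  proof -
    have "1 - c \<noteq> 0" "c \<noteq> 0" using assms by auto
    then show ?thesis
      by (simp add: divide_simps) (simp add: power2_eq_square algebra_simps)
  qed
  also have "\<dots> \<le> (norm a)\<^sup>2 / (1 - c) + (norm b)\<^sup>2 / c"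
    using assms by simp
  finally show ?thesis .
qed

text \<open>Each gradient is compared with the true gradient of the same agent at the average iterate. The
  three contributions are the sampling error, the drift of the true gradient between the agent's
  own iterate and the average (controlled by smoothness), and the disagreement of the true
  gradients at one common point (controlled by heterogeneity).\<close>

lemma (in stochastic_objectives) disagreement_gradients_le:
  fixes X :: "real^'n^'r"
  shows "disagreement (\<chi> i. v i)
    \<le> 3 * ((\<Sum>i\<in>UNIV. (norm (v i - G i (X $ i)))\<^sup>2)
          + (Max (range L))\<^sup>2 * disagreement X + real CARD('r) * \<zeta>\<^sup>2)"
proof -
  define xbar where "xbar = (1 / real CARD('r)) *\<^sub>R (\<Sum>j\<in>UNIV. X $ j)"
  define sampling :: "real^'n^'r" where "sampling = (\<chi> i. v i - G i (X $ i))"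
  define drift :: "real^'n^'r" where "drift = (\<chi> i. G i (X $ i) - G i xbar)"
  define local_grads :: "real^'n^'r" where "local_grads = (\<chi> i. G i xbar)"
  have "deviation (\<chi> i. v i) = deviation sampling + deviation drift + deviation local_grads"
    by (simp add: sampling_def drift_def local_grads_def vec_eq_iff flip: deviation_add plus_vec_def)
       (simp add: plus_vec_def)
  then have split: "disagreement (\<chi> i. v i)
      \<le> 3 * ((norm (deviation sampling))\<^sup>2 + (norm (deviation drift))\<^sup>2
          + (norm (deviation local_grads))\<^sup>2)"
    using norm_add3_power2_le by (simp add: disagreement_eq)
  have sampling_le: "(norm (deviation sampling))\<^sup>2 \<le> (\<Sum>i\<in>UNIV. (norm (v i - G i (X $ i)))\<^sup>2)"
    using disagreement_le[of sampling]
    unfolding norm_vec_power2[of sampling] disagreement_eq by (simp add: sampling_def)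
  have drift_le: "(norm (deviation drift))\<^sup>2 \<le> (Max (range L))\<^sup>2 * disagreement X"
  proof -
    have "norm (drift $ i) \<le> Max (range L) * norm (deviation X $ i)" for i
    proof -
      have "norm (drift $ i) \<le> L i * norm (deviation X $ i)"
        using lipschitz_onD[OF smooth[of i], of "X $ i" xbar]
        by (simp add: drift_def dist_norm deviation_nth xbar_def)
      also have "\<dots> \<le> Max (range L) * norm (deviation X $ i)"
        by (intro mult_right_mono Max_ge) auto
      finally show ?thesis .
    qed
    then have "(norm drift)\<^sup>2 \<le> (\<Sum>i\<in>UNIV. (Max (range L) * norm (deviation X $ i))\<^sup>2)"
      unfolding norm_vec_power2[of drift] by (intro sum_mono power_mono) auto
    also have "\<dots> = (Max (range L))\<^sup>2 * disagreement X"
      by (simp add: disagreement_eq norm_vec_power2[of "deviation X"] power_mult_distrib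
          sum_distrib_left)
    finally show ?thesis
      using disagreement_le[of drift] by (simp only: disagreement_eq)
  qed
  have local_le: "(norm (deviation local_grads))\<^sup>2 \<le> real CARD('r) * \<zeta>\<^sup>2"
    unfolding norm_vec_power2[of "deviation local_grads"]
    using sum_bounded_above[of UNIV "\<lambda>i. (norm (deviation local_grads $ i))\<^sup>2" "\<zeta>\<^sup>2"]
      heterogeneity[of _ xbar]
    by (simp add: deviation_nth local_grads_def unbiased)
  show ?thesis
    by (intro order_trans[OF split] mult_left_mono add_mono sampling_le drift_le local_le) simp
qed

lemma (in stochastic_objectives) disagreement_half_step_le:
  fixes X :: "real^'n^'r"
  assumes "0 < c" "c < 1"
  shows "disagreement (half_step g a X s v)
    \<le> disagreement X / (1 - c)
      + a\<^sup>2 / c * (2 * (\<Sum>i\<in>UNIV. (norm (v i))\<^sup>2)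
          + 6 * ((\<Sum>i\<in>UNIV. (norm (g i (X $ i) (s i) - G i (X $ i)))\<^sup>2)
              + (Max (range L))\<^sup>2 * disagreement X + real CARD('r) * \<zeta>\<^sup>2))"
proof -
  define V :: "real^'n^'r" where "V = (\<chi> i. v i)"
  define H :: "real^'n^'r" where "H = (\<chi> i. g i (X $ i) (s i))"
  have "half_step g a X s v = X - a *\<^sub>R (H + V)"
    by (simp add: half_step_def H_def V_def vec_eq_iff)
  then have "disagreement (half_step g a X s v)
      = (norm (deviation X - a *\<^sub>R (deviation H + deviation V)))\<^sup>2"
    by (simp add: disagreement_eq deviation_diff deviation_add deviation_scaleR)
  also have "\<dots> \<le> disagreement X / (1 - c) + a\<^sup>2 / c * (norm (deviation H + deviation V))\<^sup>2"
    using norm_diff_power2_le_weighted[OF assms, of "deviation X" "a *\<^sub>R (deviation H + deviation V)"]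
    by (simp add: disagreement_eq power_mult_distrib)
  finally have "disagreement (half_step g a X s v)
      \<le> disagreement X / (1 - c) + a\<^sup>2 / c * (norm (deviation H + deviation V))\<^sup>2" .
  moreover have "(norm (deviation H + deviation V))\<^sup>2
      \<le> 2 * (\<Sum>i\<in>UNIV. (norm (v i))\<^sup>2)
        + 6 * ((\<Sum>i\<in>UNIV. (norm (g i (X $ i) (s i) - G i (X $ i)))\<^sup>2)
            + (Max (range L))\<^sup>2 * disagreement X + real CARD('r) * \<zeta>\<^sup>2)" (is "_ \<le> ?b")
  proof -
    have "(norm (deviation H + deviation V))\<^sup>2 \<le> 2 * disagreement H + 2 * (norm V)\<^sup>2"
      using norm_add_power2_le[of "deviation H" "deviation V"] disagreement_le[of V]
      unfolding disagreement_eq by linarith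
    moreover have "(norm V)\<^sup>2 = (\<Sum>i\<in>UNIV. (norm (v i))\<^sup>2)"
      unfolding norm_vec_power2[of V] by (simp add: V_def)
    ultimately show ?thesis
      using disagreement_gradients_le[of "\<lambda>i. g i (X $ i) (s i)" X] unfolding H_def
      by (simp add: distrib_left)
  qed
  then have "a\<^sup>2 / c * (norm (deviation H + deviation V))\<^sup>2 \<le> a\<^sup>2 / c * ?b"
    using assms by (intro mult_left_mono) simp_all
  ultimately show ?thesis
    by linarith
qed

section \<open>Second moments of noise and samples\<close>

lemma borel_measurable_vec_iff:
  fixes f :: "'w \<Rightarrow> 'c::euclidean_space^'r::finite"
  shows "f \<in> borel_measurable M \<longleftrightarrow> (\<forall>i. (\<lambda>x. f x $ i) \<in> borel_measurable M)"
proof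
  assume f: "f \<in> borel_measurable M"
  have "(\<lambda>v :: 'c^'r. v $ i) \<in> borel_measurable borel" for i
    by (intro borel_measurable_continuous_onI continuous_intros)
  then show "\<forall>i. (\<lambda>x. f x $ i) \<in> borel_measurable M"
    using measurable_compose[OF f] by blast
next
  assume "\<forall>i. (\<lambda>x. f x $ i) \<in> borel_measurable M"
  then have [measurable]: "(\<lambda>x. f x $ i) \<in> borel_measurable M" for i by blast
  show "f \<in> borel_measurable M"
    by (subst borel_measurable_euclidean_space) (auto simp: Basis_vec_def inner_axis)
qed

lemma integrable_and_integral_le_of_nn_integral_le:
  fixes f :: "'w \<Rightarrow> real"
  assumes "f \<in> borel_measurable M" and "\<And>x. 0 \<le> f x" and "0 \<le> C"
    and "(\<integral>\<^sup>+x. ennreal (f x) \<partial>M) \<le> ennreal C"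
  shows "integrable M f" and "(\<integral>x. f x \<partial>M) \<le> C"
proof -
  show "integrable M f"
    using assms by (intro integrableI_nonneg) (auto simp: le_less_trans[OF _ ennreal_less_top])
  show "(\<integral>x. f x \<partial>M) \<le> C"
    using assms by (intro integral_real_bounded) auto
qed

text \<open>Lebesgue measure is a product measure and the density is a product, so the integral factors into
  one second moment and total masses equal to one.\<close>

lemma nn_integral_gaussian_coordinate_power2:
  fixes l :: "'n::finite"
  assumes "0 < s"
  shows "(\<integral>\<^sup>+v. ennreal (gaussian_density s v) * ennreal ((v $ l)\<^sup>2) \<partial>(lborel :: (real^'n) measure))
    = ennreal (s\<^sup>2)"
proof -
  define h :: "real^'n \<Rightarrow> real \<Rightarrow> ennreal" where
    "h b x = ennreal (normal_density 0 s x) * (if b = axis l 1 then ennreal (x\<^sup>2) else 1)" for b x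
  have Basis_eq: "(Basis :: (real^'n) set) = (\<lambda>j. axis j 1) ` UNIV"
    by (auto simp: Basis_vec_def)
  have axes_inj: "inj (\<lambda>j. axis j (1::real) :: real^'n)"
    by (rule injI) (simp add: axis_eq_axis)
  have "ennreal (gaussian_density s v) * ennreal ((v $ l)\<^sup>2) = (\<Prod>b\<in>Basis. h b (v \<bullet> b))"
    for v :: "real^'n"
  proof -
    have "(\<Prod>b\<in>Basis. h b (v \<bullet> b))
        = (\<Prod>j\<in>UNIV. ennreal (normal_density 0 s (v $ j)) * (if j = l then ennreal ((v $ j)\<^sup>2) else 1))"
      unfolding Basis_eq by (simp add: prod.reindex[OF axes_inj] h_def inner_axis axis_eq_axis
          cong: if_cong)
    also have "\<dots> = ennreal (gaussian_density s v) * ennreal ((v $ l)\<^sup>2)"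
      by (simp add: prod.distrib gaussian_density_def prod_ennreal)
    finally show ?thesis ..
  qed
  then have "(\<integral>\<^sup>+v. ennreal (gaussian_density s v) * ennreal ((v $ l)\<^sup>2) \<partial>(lborel :: (real^'n) measure))
      = (\<integral>\<^sup>+v. (\<Prod>b\<in>Basis. h b (v \<bullet> b)) \<partial>lborel)"
    by simp
  also have "\<dots> = (\<Prod>b\<in>Basis. \<integral>\<^sup>+x. h b x \<partial>lborel)"
    by (rule nn_integral_lborel_prod) (auto simp: h_def)
  also have "\<dots> = (\<Prod>b\<in>Basis. if b = (axis l 1 :: real^'n) then ennreal (s\<^sup>2) else 1)"
  proof (rule prod.cong[OF refl])
    fix b :: "real^'n"
    have "has_bochner_integral lborel (\<lambda>x. normal_density 0 s x * x\<^sup>2) (s\<^sup>2)"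
      using normal_moment_even[OF assms, of 0 1] assms
      by (simp add: field_simps power2_eq_square)
    then have "(\<integral>\<^sup>+x. ennreal (normal_density 0 s x * x\<^sup>2) \<partial>lborel) = ennreal (s\<^sup>2)"
      by (simp add: has_bochner_integral_iff nn_integral_eq_integral)
    moreover have "(\<integral>\<^sup>+x. ennreal (normal_density 0 s x) \<partial>lborel) = 1"
      using assms by (simp add: nn_integral_eq_integral)
    ultimately show "(\<integral>\<^sup>+x. h b x \<partial>lborel) = (if b = axis l 1 then ennreal (s\<^sup>2) else 1)"
      by (simp add: h_def ennreal_mult')
  qed
  also have "\<dots> = ennreal (s\<^sup>2)"
    by (subst prod.delta) auto
  finally show ?thesis .
qed

lemma (in prob_space) gaussian_norm_power2:
  fixes Z :: "'a \<Rightarrow> real^'n"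
  assumes Z: "distributed M lborel Z (gaussian_density s)" and "0 < s"
  shows "integrable M (\<lambda>\<omega>. (norm (Z \<omega>))\<^sup>2)"
    and "(\<integral>\<omega>. (norm (Z \<omega>))\<^sup>2 \<partial>M) \<le> real CARD('n) * s\<^sup>2"
proof -
  have [measurable]: "Z \<in> borel_measurable M"
    using distributed_measurable[OF Z] by simp
  have coordinate: "(\<lambda>v :: real^'n. v $ l) \<in> borel_measurable borel" for l
    by (intro borel_measurable_continuous_onI continuous_intros)
  note [measurable] = coordinate measurable_compose[OF \<open>Z \<in> borel_measurable M\<close> coordinate]
  have "(\<integral>\<^sup>+\<omega>. ennreal ((norm (Z \<omega>))\<^sup>2) \<partial>M)
      = (\<integral>\<^sup>+\<omega>. (\<Sum>l\<in>UNIV. ennreal ((Z \<omega> $ l)\<^sup>2)) \<partial>M)"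
    by (simp add: norm_vec_power2 sum_ennreal)
  also have "\<dots> = (\<Sum>l\<in>UNIV. \<integral>\<^sup>+\<omega>. ennreal ((Z \<omega> $ l)\<^sup>2) \<partial>M)"
    by (rule nn_integral_sum) simp
  also have "\<dots> = (\<Sum>l\<in>(UNIV::'n set). ennreal (s\<^sup>2))"
    using distributed_nn_integral[OF Z, of "\<lambda>v. ennreal ((v $ _)\<^sup>2)"]
    by (simp add: nn_integral_gaussian_coordinate_power2[OF \<open>0 < s\<close>])
  also have "\<dots> = ennreal (real CARD('n) * s\<^sup>2)"
    by (simp add: ennreal_mult ennreal_of_nat_eq_real_of_nat)
  finally have "(\<integral>\<^sup>+\<omega>. ennreal ((norm (Z \<omega>))\<^sup>2) \<partial>M) \<le> ennreal (real CARD('n) * s\<^sup>2)"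
    by simp
  note bound = integrable_and_integral_le_of_nn_integral_le[OF _ _ _ this]
  show "integrable M (\<lambda>\<omega>. (norm (Z \<omega>))\<^sup>2)"
    and "(\<integral>\<omega>. (norm (Z \<omega>))\<^sup>2 \<partial>M) \<le> real CARD('n) * s\<^sup>2"
    by (rule bound; simp)+
qed

text \<open>Independence is required of \<open>\<sigma>\<close>-algebras that contain all preimages, such as the information
  available before an iteration; this fixes the joint law on rectangles, which generate the product.\<close>

lemma (in prob_space) pair_distr_eq_of_indep_set:
  assumes U[measurable]: "U \<in> measurable M S" and V[measurable]: "V \<in> measurable M T"
    and indep: "indep_set A B"
    and A: "\<And>a. a \<in> sets S \<Longrightarrow> U -` a \<inter> space M \<in> A"
    and B: "\<And>b. b \<in> sets T \<Longrightarrow> V -` b \<inter> space M \<in> B"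
  shows "distr M S U \<Otimes>\<^sub>M distr M T V = distr M (S \<Otimes>\<^sub>M T) (\<lambda>\<omega>. (U \<omega>, V \<omega>))"
proof -
  interpret U: prob_space "distr M S U" by (rule prob_space_distr[OF U])
  interpret V: prob_space "distr M T V" by (rule prob_space_distr[OF V])
  show ?thesis
  proof (rule pair_measure_eqI)
    show "sigma_finite_measure (distr M S U)" "sigma_finite_measure (distr M T V)"
      by unfold_locales
    show "sets (distr M S U \<Otimes>\<^sub>M distr M T V)
        = sets (distr M (S \<Otimes>\<^sub>M T) (\<lambda>\<omega>. (U \<omega>, V \<omega>)))"
      by simp
  next
    fix a b assume "a \<in> sets (distr M S U)" "b \<in> sets (distr M T V)"
    then have [measurable]: "a \<in> sets S" "b \<in> sets T" by simp_all
    have "(\<lambda>\<omega>. (U \<omega>, V \<omega>)) -` (a \<times> b) \<inter> space M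
        = (U -` a \<inter> space M) \<inter> (V -` b \<inter> space M)"
      by auto
    moreover have "prob ((U -` a \<inter> space M) \<inter> (V -` b \<inter> space M))
        = prob (U -` a \<inter> space M) * prob (V -` b \<inter> space M)"
      using indep A[of a] B[of b] by (intro indep_setD) auto
    ultimately show "emeasure (distr M S U) a * emeasure (distr M T V) b
        = emeasure (distr M (S \<Otimes>\<^sub>M T) (\<lambda>\<omega>. (U \<omega>, V \<omega>))) (a \<times> b)"
      by (simp add: emeasure_distr emeasure_eq_measure ennreal_mult)
  qed
qed

text \<open>A bound that holds with the first variable frozen at any value survives averaging over an
  independent first variable.\<close>

lemma (in prob_space) nn_integral_le_of_pair_distr_eq:
  assumes U: "U \<in> measurable M S" and V: "V \<in> measurable M T"
    and joint: "distr M S U \<Otimes>\<^sub>M distr M T V = distr M (S \<Otimes>\<^sub>M T) (\<lambda>\<omega>. (U \<omega>, V \<omega>))"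
    and h: "h \<in> borel_measurable (S \<Otimes>\<^sub>M T)"
    and le: "\<And>u. u \<in> space S \<Longrightarrow> (\<integral>\<^sup>+v. h (u, v) \<partial>distr M T V) \<le> C"
  shows "(\<integral>\<^sup>+\<omega>. h (U \<omega>, V \<omega>) \<partial>M) \<le> C"
proof -
  note [measurable] = U V
  interpret U: prob_space "distr M S U" by (rule prob_space_distr[OF U])
  interpret V: prob_space "distr M T V" by (rule prob_space_distr[OF V])
  have "(\<integral>\<^sup>+\<omega>. h (U \<omega>, V \<omega>) \<partial>M) = (\<integral>\<^sup>+p. h p \<partial>(distr M S U \<Otimes>\<^sub>M distr M T V))"
    unfolding joint using h by (subst nn_integral_distr) auto
  also have "\<dots> = (\<integral>\<^sup>+u. \<integral>\<^sup>+v. h (u, v) \<partial>distr M T V \<partial>distr M S U)"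
    using h by (intro V.nn_integral_fst[symmetric]) (simp cong: measurable_cong_sets)
  also have "\<dots> \<le> (\<integral>\<^sup>+u. C \<partial>distr M S U)"
    by (intro nn_integral_mono le) simp
  also have "\<dots> = C"
    using U.emeasure_space_1 by simp
  finally show ?thesis .
qed

section \<open>One iteration in expectation\<close>

locale private_training =
  byzantine_network Byz E w
  + stochastic_objectives law f g G L \<sigma> \<zeta>
  + dp_scc_pl M E w law g F \<xi> noise noise_std varpi msg \<tau> \<alpha> X0 X Y
  for Byz :: "'b set"
    and E :: "(('r::finite + 'b) \<times> ('r + 'b)) set"
    and w :: "'r + 'b \<Rightarrow> 'r + 'b \<Rightarrow> real"
    and law :: "'r \<Rightarrow> 's measure"
    and f :: "'r \<Rightarrow> real^'n \<Rightarrow> 's \<Rightarrow> real"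
    and g :: "'r \<Rightarrow> real^'n \<Rightarrow> 's \<Rightarrow> real^'n"
    and G :: "'r \<Rightarrow> real^'n \<Rightarrow> real^'n"
    and L :: "'r \<Rightarrow> real"
    and \<sigma> \<zeta> :: real
    and M :: "'w measure"
    and F :: "nat \<Rightarrow> 'w measure"
    and \<xi> :: "'r \<Rightarrow> nat \<Rightarrow> 'w \<Rightarrow> 's"
    and noise :: "'r \<Rightarrow> nat \<Rightarrow> 'w \<Rightarrow> real^'n"
    and noise_std :: "'r \<Rightarrow> nat \<Rightarrow> real"
    and varpi :: "'r \<Rightarrow> real"
    and msg :: "nat \<Rightarrow> 'w \<Rightarrow> 'b \<Rightarrow> 'r \<Rightarrow> real^'n"
    and \<tau> :: "'r \<Rightarrow> nat \<Rightarrow> 'w \<Rightarrow> real"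
    and \<alpha> :: "nat \<Rightarrow> real"
    and X0 :: "real^'n^'r"
    and X Y :: "nat \<Rightarrow> 'w \<Rightarrow> real^'n^'r"
begin

lemma space_F: "space (F k) = space M"
  using filtration(1) by (simp add: subalgebra_def)

lemma measurable_F_Suc: "h \<in> measurable (F k) N \<Longrightarrow> h \<in> measurable (F (Suc k)) N"
  using filtration(2)[of k] by (auto simp: measurable_def space_F)

text \<open>Adaptedness of the iterates is what makes \<open>X k\<close> independent of the samples drawn at iteration \<open>k\<close>.
  Messages and clipping parameters enter only through their measurability.\<close>

lemma messages_adapted:
  assumes X: "X k \<in> borel_measurable (F k)"
  shows "Y k \<in> borel_measurable (F (Suc k))"
proof -
  have row[measurable]: "(\<lambda>\<omega>. X k \<omega> $ i) \<in> borel_measurable (F (Suc k))" for i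
    using measurable_F_Suc[OF X] by (simp add: borel_measurable_vec_iff)
  have [measurable]: "(\<lambda>\<omega>. g i (X k \<omega> $ i) (\<xi> i k \<omega>)) \<in> borel_measurable (F (Suc k))" for i
    using measurable_compose[OF measurable_Pair[OF row sample_adapted] measurable_gradient]
    by simp
  note [measurable] = noise_adapted
  have "(\<lambda>\<omega>. half_step g (\<alpha> k) (X k \<omega>) (\<lambda>i. \<xi> i k \<omega>) (\<lambda>i. noise i k \<omega>))
      \<in> borel_measurable (F (Suc k))"
    by (simp add: borel_measurable_vec_iff[where 'r='r] half_step_def)
  then show ?thesis
    by (rule measurable_cong[THEN iffD1, rotated]) (simp add: space_F local_step)
qed

lemma iterates_adapted: "X k \<in> borel_measurable (F k)"
proof (induction k)
  case 0
  have "(\<lambda>\<omega>. X0) \<in> borel_measurable (F 0)" by simp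
  then show ?case
    by (rule measurable_cong[THEN iffD1, rotated]) (simp add: space_F init)
next
  case (Suc k)
  have "(\<lambda>\<omega>. received (Y k \<omega>) (msg k \<omega>) i u) \<in> borel_measurable (F (Suc k))" for i u
    using messages_adapted[OF Suc] msg_adapted
    by (cases u) (simp_all add: received_def borel_measurable_vec_iff[where 'r='r])
  note [measurable] = this clipping_adapted
  have "(\<lambda>\<omega>. \<chi> i. scc E w (\<tau> i k \<omega>) i (received (Y k \<omega>) (msg k \<omega>) i))
      \<in> borel_measurable (F (Suc k))"
    by (simp add: borel_measurable_vec_iff[where 'r='r] scc_def clip_def)
  then show ?case
    by (rule measurable_cong[THEN iffD1, rotated]) (simp add: space_F aggregation)
qed

lemma row_adapted: "(\<lambda>\<omega>. X k \<omega> $ i) \<in> borel_measurable (F k)"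
  using iterates_adapted[of k] by (simp add: borel_measurable_vec_iff[where 'r='r])

lemma row_measurable: "(\<lambda>\<omega>. X k \<omega> $ i) \<in> borel_measurable M"
  by (rule measurable_from_subalg[OF filtration(1) row_adapted])

lemma sample_measurable: "\<xi> i k \<in> measurable M (law i)"
  by (rule measurable_from_subalg[OF filtration(1) sample_adapted])

lemma iterate_sample_joint_law:
  "distr M borel (\<lambda>\<omega>. X k \<omega> $ i) \<Otimes>\<^sub>M distr M (law i) (\<xi> i k)
    = distr M (borel \<Otimes>\<^sub>M law i) (\<lambda>\<omega>. (X k \<omega> $ i, \<xi> i k \<omega>))"
  using measurable_sets[OF row_adapted, of _ k i]
  by (intro pair_distr_eq_of_indep_set[OF row_measurable sample_measurable sample_indep_past[of k i]])
     (auto simp: space_F intro: in_vimage_algebra)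

text \<open>The variance bound holds at each fixed point; independence of the sample from the past transfers
  it to the random point \<open>X k\<close>.\<close>

lemma sampling_error:
  shows "integrable M (\<lambda>\<omega>. (norm (g i (X k \<omega> $ i) (\<xi> i k \<omega>) - G i (X k \<omega> $ i)))\<^sup>2)"
    and "(\<integral>\<omega>. (norm (g i (X k \<omega> $ i) (\<xi> i k \<omega>) - G i (X k \<omega> $ i)))\<^sup>2 \<partial>M) \<le> \<sigma>\<^sup>2"
proof -
  have G: "G i \<in> borel_measurable borel"
    by (intro borel_measurable_continuous_onI lipschitz_on_continuous_on[OF smooth])
  have [measurable]: "(\<lambda>p. g i (fst p) (snd p)) \<in> borel_measurable (borel \<Otimes>\<^sub>M law i)"
    using measurable_gradient[of i] by (simp add: case_prod_beta')
  have [measurable]: "(\<lambda>p. G i (fst p)) \<in> borel_measurable (borel \<Otimes>\<^sub>M law i)"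
    by (rule measurable_compose[OF measurable_fst G])
  have h[measurable]:
      "(\<lambda>p. (norm (g i (fst p) (snd p) - G i (fst p)))\<^sup>2) \<in> borel_measurable (borel \<Otimes>\<^sub>M law i)"
    by measurable
  have "(\<integral>\<^sup>+s. ennreal ((norm (g i x s - G i x))\<^sup>2) \<partial>law i) \<le> ennreal (\<sigma>\<^sup>2)" for x
    using integrable_variance[of i x] variance[of i x]
    by (simp add: nn_integral_eq_integral ennreal_leI)
  then have "(\<integral>\<^sup>+\<omega>. ennreal ((norm (g i (X k \<omega> $ i) (\<xi> i k \<omega>) - G i (X k \<omega> $ i)))\<^sup>2) \<partial>M)
      \<le> ennreal (\<sigma>\<^sup>2)"
    using nn_integral_le_of_pair_distr_eq[OF row_measurable sample_measurable
          iterate_sample_joint_law[of k i],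
        of "\<lambda>p. ennreal ((norm (g i (fst p) (snd p) - G i (fst p)))\<^sup>2)" "ennreal (\<sigma>\<^sup>2)"]
    by (simp add: sample_law)
  note nn_bound = this
  have "(\<lambda>\<omega>. (norm (g i (X k \<omega> $ i) (\<xi> i k \<omega>) - G i (X k \<omega> $ i)))\<^sup>2) \<in> borel_measurable M"
    using measurable_compose[OF measurable_Pair[OF row_measurable sample_measurable] h] by simp
  note bound = integrable_and_integral_le_of_nn_integral_le[OF this _ _ nn_bound]
  show "integrable M (\<lambda>\<omega>. (norm (g i (X k \<omega> $ i) (\<xi> i k \<omega>) - G i (X k \<omega> $ i)))\<^sup>2)"
    and "(\<integral>\<omega>. (norm (g i (X k \<omega> $ i) (\<xi> i k \<omega>) - G i (X k \<omega> $ i)))\<^sup>2 \<partial>M) \<le> \<sigma>\<^sup>2"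
    by (rule bound; simp)+
qed

lemma noise_energy:
  shows "integrable M (\<lambda>\<omega>. (norm (noise i k \<omega>))\<^sup>2)"
    and "(\<integral>\<omega>. (norm (noise i k \<omega>))\<^sup>2 \<partial>M) \<le> real CARD('n) * Max (range (\<lambda>i. (varpi i)\<^sup>2))"
proof -
  note gaussian = gaussian_norm_power2[OF noise_law noise_std_bounds(1), of i k]
  show "integrable M (\<lambda>\<omega>. (norm (noise i k \<omega>))\<^sup>2)"
    by (rule gaussian)
  have "(noise_std i k)\<^sup>2 \<le> Max (range (\<lambda>i. (varpi i)\<^sup>2))"
    by (rule order_trans[OF noise_std_bounds(2)]) (simp add: Max_ge)
  then show "(\<integral>\<omega>. (norm (noise i k \<omega>))\<^sup>2 \<partial>M) \<le> real CARD('n) * Max (range (\<lambda>i. (varpi i)\<^sup>2))"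
    by (intro order_trans[OF gaussian(2)] mult_left_mono) auto
qed

lemma disagreement_measurable: "(\<lambda>\<omega>. disagreement (X k \<omega>)) \<in> borel_measurable M"
proof -
  note [measurable] = row_measurable
  have [measurable]: "(\<lambda>\<omega>. deviation (X k \<omega>)) \<in> borel_measurable M"
    by (simp add: borel_measurable_vec_iff[where 'r='r] deviation_nth)
  show ?thesis
    by (simp add: disagreement_eq)
qed

text \<open>The half-step bound is pointwise and treats the injected noise by the triangle inequality only, so
  the noise may be correlated with everything else. Expectations are taken at the very end, where
  only second moments enter.\<close>

lemma expected_disagreement_step:
  assumes integrable: "integrable M (\<lambda>\<omega>. disagreement (X k \<omega>))"
    and scc: "\<And>\<omega>. \<omega> \<in> space M \<Longrightarrow> disagreement (X (Suc k) \<omega>) \<le> q * disagreement (Y k \<omega>)"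
    and "0 \<le> q" and c: "0 < c" "c < 1"
  defines "V \<equiv> real CARD('n) * Max (range (\<lambda>i. (varpi i)\<^sup>2))"
  shows "integrable M (\<lambda>\<omega>. disagreement (X (Suc k) \<omega>))"
    and "(\<integral>\<omega>. disagreement (X (Suc k) \<omega>) \<partial>M)
      \<le> q * ((1 / (1 - c) + 6 * (\<alpha> k * Max (range L))\<^sup>2 / c) * (\<integral>\<omega>. disagreement (X k \<omega>) \<partial>M)
          + (\<alpha> k)\<^sup>2 / c * (real CARD('r) * (2 * V + 6 * (\<sigma>\<^sup>2 + \<zeta>\<^sup>2))))"
proof -
  define S where "S \<omega> = (\<Sum>i\<in>UNIV. (norm (g i (X k \<omega> $ i) (\<xi> i k \<omega>) - G i (X k \<omega> $ i)))\<^sup>2)" for \<omega>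
  define N where "N \<omega> = (\<Sum>i\<in>UNIV. (norm (noise i k \<omega>))\<^sup>2)" for \<omega>
  define B where "B \<omega> = q * (disagreement (X k \<omega>) / (1 - c) + (\<alpha> k)\<^sup>2 / c *
      (2 * N \<omega> + 6 * (S \<omega> + (Max (range L))\<^sup>2 * disagreement (X k \<omega>) + real CARD('r) * \<zeta>\<^sup>2)))" for \<omega>
  have pointwise: "disagreement (X (Suc k) \<omega>) \<le> B \<omega>" if "\<omega> \<in> space M" for \<omega>
    using disagreement_half_step_le[OF c, of "\<alpha> k" "X k \<omega>" "\<lambda>i. \<xi> i k \<omega>" "\<lambda>i. noise i k \<omega>"]
      scc[OF that] \<open>0 \<le> q\<close> local_step[OF that, of k]
    by (fastforce simp: B_def S_def N_def intro: order_trans mult_left_mono)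
  have S: "integrable M S" "(\<integral>\<omega>. S \<omega> \<partial>M) \<le> real CARD('r) * \<sigma>\<^sup>2"
    using sum_mono[of UNIV, OF sampling_error(2)[of _ k]] sampling_error(1)
    by (simp_all add: S_def[abs_def])
  have N: "integrable M N" "(\<integral>\<omega>. N \<omega> \<partial>M) \<le> real CARD('r) * V"
    using sum_mono[of UNIV, OF noise_energy(2)[of _ k]] noise_energy(1)
    by (simp_all add: N_def[abs_def] V_def)
  have B: "integrable M B"
    using S(1) N(1) integrable by (simp add: B_def[abs_def])
  show "integrable M (\<lambda>\<omega>. disagreement (X (Suc k) \<omega>))"
    using pointwise
    by (intro Bochner_Integration.integrable_bound[OF B disagreement_measurable] AE_I2)
       (fastforce simp: disagreement_eq)
  then have "(\<integral>\<omega>. disagreement (X (Suc k) \<omega>) \<partial>M) \<le> (\<integral>\<omega>. B \<omega> \<partial>M)"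
    using B pointwise by (intro integral_mono) auto
  also have "(\<integral>\<omega>. B \<omega> \<partial>M) = q * ((\<integral>\<omega>. disagreement (X k \<omega>) \<partial>M) / (1 - c) + (\<alpha> k)\<^sup>2 / c *
      (2 * (\<integral>\<omega>. N \<omega> \<partial>M) + 6 * ((\<integral>\<omega>. S \<omega> \<partial>M)
        + (Max (range L))\<^sup>2 * (\<integral>\<omega>. disagreement (X k \<omega>) \<partial>M) + real CARD('r) * \<zeta>\<^sup>2)))"
    using S(1) N(1) integrable by (simp add: B_def[abs_def] prob_space)
  also have "\<dots> \<le> q * ((\<integral>\<omega>. disagreement (X k \<omega>) \<partial>M) / (1 - c) + (\<alpha> k)\<^sup>2 / c *
      (2 * (real CARD('r) * V) + 6 * (real CARD('r) * \<sigma>\<^sup>2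
        + (Max (range L))\<^sup>2 * (\<integral>\<omega>. disagreement (X k \<omega>) \<partial>M) + real CARD('r) * \<zeta>\<^sup>2)))"
    using S(2) N(2) \<open>0 \<le> q\<close> c by (intro mult_left_mono add_mono order_refl) auto
  also have "\<dots> = q * ((1 / (1 - c) + 6 * (\<alpha> k * Max (range L))\<^sup>2 / c)
        * (\<integral>\<omega>. disagreement (X k \<omega>) \<partial>M)
      + (\<alpha> k)\<^sup>2 / c * (real CARD('r) * (2 * V + 6 * (\<sigma>\<^sup>2 + \<zeta>\<^sup>2))))"
    by (simp add: algebra_simps power_mult_distrib add_divide_distrib)
  finally show "(\<integral>\<omega>. disagreement (X (Suc k) \<omega>) \<partial>M)
      \<le> q * ((1 / (1 - c) + 6 * (\<alpha> k * Max (range L))\<^sup>2 / c) * (\<integral>\<omega>. disagreement (X k \<omega>) \<partial>M)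
          + (\<alpha> k)\<^sup>2 / c * (real CARD('r) * (2 * V + 6 * (\<sigma>\<^sup>2 + \<zeta>\<^sup>2))))" .
qed

end

section \<open>Solving the recursion\<close>

lemma contraction_factor_le:
  fixes \<phi> vphi b :: real
  assumes "0 < \<phi>" "3 * \<phi> \<le> vphi" "vphi < 1" "0 \<le> b" "b \<le> \<phi> / 8"
  shows "(1 - vphi) * (1 / (1 - \<phi>) + b) \<le> 1 - 3 / 2 * \<phi>"
proof -
  have "(1 - vphi) * (1 / (1 - \<phi>) + b) \<le> (1 - 3 * \<phi>) * (1 / (1 - \<phi>) + \<phi> / 8)"
    using assms by (intro mult_mono add_mono) auto
  also have "\<dots> \<le> (1 - 2 * \<phi>) + \<phi> / 8"
  proof -
    have "(1 - 3 * \<phi>) / (1 - \<phi>) \<le> 1 - 2 * \<phi>"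
      using assms by (subst pos_divide_le_eq) (auto simp: algebra_simps)
    moreover have "(1 - 3 * \<phi>) * (\<phi> / 8) \<le> \<phi> / 8"
      using assms by (simp add: algebra_simps)
    ultimately show ?thesis
      by (simp add: distrib_left)
  qed
  also have "\<dots> \<le> 1 - 3 / 2 * \<phi>"
    using assms by simp
  finally show ?thesis .
qed

text \<open>A comparison principle: the initial value decays geometrically, and the source terms are absorbed
  by any nonnegative supersolution \<open>s\<close> of the recursion.\<close>

lemma recursion_le_supersolution:
  fixes e b s :: "nat \<Rightarrow> real"
  assumes "\<And>k. e (Suc k) \<le> q * e k + b k" and "\<And>k. q * s k + b k \<le> s (Suc k)"
    and "0 \<le> s 0" "0 \<le> q"
  shows "e k \<le> q ^ k * e 0 + s k"
proof (induction k)
  case 0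
  then show ?case using assms by simp
next
  case (Suc k)
  have "e (Suc k) \<le> q * e k + b k" by fact
  also have "\<dots> \<le> q * (q ^ k * e 0 + s k) + b k"
    using Suc \<open>0 \<le> q\<close> by (simp add: mult_left_mono)
  also have "\<dots> \<le> q ^ Suc k * e 0 + s (Suc k)"
    using assms(2)[of k] by (simp add: algebra_simps)
  finally show ?case .
qed

text \<open>From \<open>t > 2 / \<phi>\<close> on, \<open>1 / t\<^sup>2\<close> decreases more slowly than geometrically with rate \<open>1 - \<phi>\<close>; this
  is the role of the condition \<open>k0 > 2 / \<phi>\<close>.\<close>

lemma inverse_square_decay_ge:
  fixes t \<phi> :: real
  assumes "2 / \<phi> < t" "0 < \<phi>" "\<phi> \<le> 1"
  shows "(1 - \<phi>) / t\<^sup>2 \<le> 1 / (t + 1)\<^sup>2"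
proof -
  have "0 < t" using assms by (smt (verit) divide_pos_pos)
  have "2 \<le> \<phi> * t" using assms by (simp add: field_simps)
  then have "2 * (t + 1) \<le> \<phi> * t * (t + 1)" using \<open>0 < t\<close> by (intro mult_right_mono) auto
  moreover have "0 \<le> \<phi> * (t + 1)" using assms \<open>0 < t\<close> by simp
  ultimately have "(1 - \<phi>) * (t + 1)\<^sup>2 \<le> t\<^sup>2" by (simp add: power2_eq_square algebra_simps)
  then show ?thesis using \<open>0 < t\<close> by (simp add: field_simps)
qed

context private_training begin

text \<open>Young's inequality is applied with weight \<open>c = \<phi>\<close>. The step-size bound makes the smoothness term
  at most \<open>\<phi> / 8\<close>, and \<open>1 - vphi \<le> 1 - 3 \<phi>\<close> then leaves the rate \<open>1 - 3 \<phi> / 2\<close> rather than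
  \<open>1 - \<phi>\<close>, while the source is at most half of \<open>vtheta (\<alpha> k)\<^sup>2\<close>. Both gains are spent in the
  decaying case, where \<open>\<iota>\<close> may be arbitrarily close to one.\<close>

lemma disagreement_recursion:
  fixes vphi \<phi> \<theta> vtheta :: real
  assumes scc: "\<And>k \<omega>. \<omega> \<in> space M \<Longrightarrow>
        disagreement (X (Suc k) \<omega>) \<le> (1 - vphi) * disagreement (Y k \<omega>)"
    and phi: "0 < \<phi>" "3 * \<phi> \<le> vphi" "vphi < 1"
    and theta: "\<theta> = \<phi> / (4 * sqrt 3 * Max (range L))"
    and vtheta: "vtheta = 4 * real CARD('r) *
          (real CARD('n) * Max (range (\<lambda>i. (varpi i)\<^sup>2)) + 4 * (\<sigma>\<^sup>2 + \<zeta>\<^sup>2)) / \<phi>"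
    and step_size: "\<And>k. \<alpha> k \<le> \<theta>"
  shows "integrable M (\<lambda>\<omega>. disagreement (X k \<omega>))"
    and "(\<integral>\<omega>. disagreement (X (Suc k) \<omega>) \<partial>M)
      \<le> (1 - 3 / 2 * \<phi>) * (\<integral>\<omega>. disagreement (X k \<omega>) \<partial>M) + vtheta / 2 * (\<alpha> k)\<^sup>2"
proof -
  have "0 \<le> 1 - vphi" "\<phi> < 1" using phi by simp_all
  note step = expected_disagreement_step[OF _ scc \<open>0 \<le> 1 - vphi\<close> \<open>0 < \<phi>\<close> \<open>\<phi> < 1\<close>]
  have integrable: "integrable M (\<lambda>\<omega>. disagreement (X k \<omega>))" for k
  proof (induction k)
    case 0
    have "integrable M (\<lambda>\<omega>. disagreement (X 0 \<omega>)) \<longleftrightarrow> integrable M (\<lambda>\<omega>. disagreement X0)"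
      by (intro Bochner_Integration.integrable_cong) (simp_all add: init)
    then show ?case by simp
  next
    case (Suc k)
    then show ?case by (rule step(1))
  qed
  then show "integrable M (\<lambda>\<omega>. disagreement (X k \<omega>))" .
  define Lmax where "Lmax = Max (range L)"
  define V where "V = real CARD('n) * Max (range (\<lambda>i. (varpi i)\<^sup>2))"
  define e where "e = (\<integral>\<omega>. disagreement (X k \<omega>) \<partial>M)"
  have "0 \<le> e" by (simp add: e_def disagreement_eq)
  have "0 < Lmax"
    using L_pos by (simp add: Lmax_def Max_gr_iff)
  have "0 \<le> V"
    unfolding V_def by (intro mult_nonneg_nonneg order_trans[OF zero_le_power2 Max_ge]) auto
  have smoothness: "6 * (\<alpha> k * Lmax)\<^sup>2 / \<phi> \<le> \<phi> / 8"
  proof -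
    have "\<alpha> k * Lmax \<le> \<phi> / (4 * sqrt 3)"
      using mult_right_mono[OF step_size[of k], of Lmax] \<open>0 < Lmax\<close>
      by (simp add: theta flip: Lmax_def)
    then have "(\<alpha> k * Lmax)\<^sup>2 \<le> (\<phi> / (4 * sqrt 3))\<^sup>2"
      using step_size_pos[of k] \<open>0 < Lmax\<close> by (intro power_mono) auto
    also have "\<dots> = \<phi>\<^sup>2 / 48"
      by (simp add: power_divide power_mult_distrib)
    finally show ?thesis
      using \<open>0 < \<phi>\<close> by (simp add: pos_divide_le_eq power2_eq_square)
  qed
  have "(\<integral>\<omega>. disagreement (X (Suc k) \<omega>) \<partial>M)
      \<le> (1 - vphi) * ((1 / (1 - \<phi>) + 6 * (\<alpha> k * Lmax)\<^sup>2 / \<phi>) * e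
          + (\<alpha> k)\<^sup>2 / \<phi> * (real CARD('r) * (2 * V + 6 * (\<sigma>\<^sup>2 + \<zeta>\<^sup>2))))"
    unfolding e_def V_def Lmax_def by (rule step(2)[OF integrable])
  also have "\<dots> = (1 - vphi) * (1 / (1 - \<phi>) + 6 * (\<alpha> k * Lmax)\<^sup>2 / \<phi>) * e
      + (1 - vphi) * ((\<alpha> k)\<^sup>2 / \<phi> * (real CARD('r) * (2 * V + 6 * (\<sigma>\<^sup>2 + \<zeta>\<^sup>2))))"
    by (subst distrib_left) (simp only: mult.assoc)
  also have "\<dots> \<le> (1 - 3 / 2 * \<phi>) * e
      + 1 * ((\<alpha> k)\<^sup>2 / \<phi> * (real CARD('r) * (2 * V + 8 * (\<sigma>\<^sup>2 + \<zeta>\<^sup>2))))"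
    using phi \<open>0 \<le> e\<close> \<open>0 \<le> V\<close> smoothness \<open>0 \<le> 1 - vphi\<close>
    by (intro add_mono mult_right_mono mult_mono mult_left_mono contraction_factor_le) auto
  also have "1 * ((\<alpha> k)\<^sup>2 / \<phi> * (real CARD('r) * (2 * V + 8 * (\<sigma>\<^sup>2 + \<zeta>\<^sup>2)))) = vtheta / 2 * (\<alpha> k)\<^sup>2"
    by (simp add: vtheta algebra_simps add_divide_distrib flip: V_def)
  finally show "(\<integral>\<omega>. disagreement (X (Suc k) \<omega>) \<partial>M)
      \<le> (1 - 3 / 2 * \<phi>) * (\<integral>\<omega>. disagreement (X k \<omega>) \<partial>M) + vtheta / 2 * (\<alpha> k)\<^sup>2"
    by (simp add: e_def)
qed

end

theorem theorem1:
  fixes Byz :: "'b set"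
    and E :: "(('r::finite + 'b) \<times> ('r + 'b)) set"
    and w :: "'r + 'b \<Rightarrow> 'r + 'b \<Rightarrow> real"
    and law :: "'r \<Rightarrow> 's measure"
    and f :: "'r \<Rightarrow> real^'n \<Rightarrow> 's \<Rightarrow> real"
    and g :: "'r \<Rightarrow> real^'n \<Rightarrow> 's \<Rightarrow> real^'n"
    and G :: "'r \<Rightarrow> real^'n \<Rightarrow> real^'n"
    and L :: "'r \<Rightarrow> real"
    and \<sigma> \<zeta> :: real
    and M :: "'w measure"
    and F :: "nat \<Rightarrow> 'w measure"
    and \<xi> :: "'r \<Rightarrow> nat \<Rightarrow> 'w \<Rightarrow> 's"
    and noise :: "'r \<Rightarrow> nat \<Rightarrow> 'w \<Rightarrow> real^'n"
    and noise_std :: "'r \<Rightarrow> nat \<Rightarrow> real"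
    and varpi :: "'r \<Rightarrow> real"
    and msg :: "nat \<Rightarrow> 'w \<Rightarrow> 'b \<Rightarrow> 'r \<Rightarrow> real^'n"
    and \<tau> :: "'r \<Rightarrow> nat \<Rightarrow> 'w \<Rightarrow> real"
    and \<alpha> :: "nat \<Rightarrow> real"
    and X0 :: "real^'n^'r"
    and X Y :: "nat \<Rightarrow> 'w \<Rightarrow> real^'n^'r"
    and \<rho> lam vphi \<eta> \<phi> vtheta \<theta> k0 \<iota> rhobar :: real
  assumes network: "byzantine_network Byz E w"
    and objectives: "stochastic_objectives law f g G L \<sigma> \<zeta>"
    and algorithm: "dp_scc_pl M E w law g F \<xi> noise noise_std varpi msg \<tau> \<alpha> X0 X Y"
    and contraction: "\<And>i k \<omega>. \<omega> \<in> space M \<Longrightarrow>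
          scc_contraction E w \<rho> (\<tau> i k \<omega>) i (received (Y k \<omega>) (msg k \<omega>) i)"
    and lam: "lam = 1 - (onorm ((*v) (virtual_weights E w - averaging)))\<^sup>2"
    and vphi: "vphi = lam - 4 * \<rho> * sqrt (real CARD('r))"
    and eta: "\<eta> = vphi / 2"
    and phi: "\<phi> = vphi / (4 - vphi)"
    and vtheta: "vtheta = 4 * real CARD('r) *
          (real CARD('n) * Max (range (\<lambda>i. (varpi i)\<^sup>2)) + 4 * (\<sigma>\<^sup>2 + \<zeta>\<^sup>2)) / \<phi>"
    and theta: "\<theta> = \<phi> / (4 * sqrt 3 * Max (range L))"
    and k0: "k0 > 2 / \<phi>"
    and iota: "\<iota> \<ge> (1 + 1 / k0)\<^sup>2"
    and rhobar: "rhobar = lam / (4 * sqrt (real CARD('r)))"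
    and rho_range: "0 \<le> \<rho>" "\<rho> < rhobar"
    and unit_range: "vphi \<in> {0<..<1}" "\<eta> \<in> {0<..<1}" "\<phi> \<in> {0<..<1}"
  shows "((\<forall>k. \<alpha> k = \<theta> / (real k + k0)) \<longrightarrow>
            (\<forall>k. integrable M (\<lambda>\<omega>. disagreement (X k \<omega>)) \<and>
                 (\<integral>\<omega>. disagreement (X k \<omega>) \<partial>M)
                   \<le> (1 - \<phi>) ^ k * disagreement X0
                      + 2 * \<iota> * vtheta * \<theta>\<^sup>2 / \<phi> * (1 / (real k + k0)\<^sup>2)))
       \<and> (\<forall>a. 0 < a \<and> a \<le> \<theta> \<and> (\<forall>k. \<alpha> k = a) \<longrightarrow>
            (\<forall>k. integrable M (\<lambda>\<omega>. disagreement (X k \<omega>)) \<and>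
                 (\<integral>\<omega>. disagreement (X k \<omega>) \<partial>M)
                   \<le> (1 - \<phi>) ^ k * disagreement X0 + vtheta / \<phi> * a\<^sup>2))"
proof -
  interpret private_training Byz E w law f g G L \<sigma> \<zeta> M F \<xi> noise noise_std varpi msg \<tau> \<alpha> X0 X Y
    using network objectives algorithm by (simp add: private_training_def)
  \<comment> \<open>\<open>\<phi> = vphi / (4 - vphi)\<close> and \<open>4 - vphi > 3\<close>.\<close>
  have phi_pos: "0 < \<phi>" and phi_le: "3 * \<phi> \<le> vphi" and vphi_less: "vphi < 1"
    using unit_range by (auto simp: phi field_simps)
  then have "3 * \<phi> < 1" by simp
  have "4 * \<rho> * sqrt (real CARD('r)) \<le> lam"
    using unit_range(1) vphi by simp
  then have scc: "disagreement (X (Suc k) \<omega>) \<le> (1 - vphi) * disagreement (Y k \<omega>)"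
    if "\<omega> \<in> space M" for k \<omega>
    unfolding vphi aggregation[OF that]
    by (intro disagreement_scc_le[OF network contraction[OF that] lam rho_range(1)])
  note recursion = disagreement_recursion[OF _ phi_pos phi_le vphi_less theta vtheta]
  have "0 < Max (range L)"
    using L_pos by (simp add: Max_gr_iff)
  then have "0 < \<theta>" using phi_pos by (simp add: theta)
  have "0 \<le> Max (range (\<lambda>i. (varpi i)\<^sup>2))"
    by (rule order_trans[OF zero_le_power2 Max_ge]) auto
  then have "0 \<le> vtheta" using phi_pos by (simp add: vtheta)
  define e where "e k = (\<integral>\<omega>. disagreement (X k \<omega>) \<partial>M)" for k
  have "e 0 = (\<integral>\<omega>. disagreement X0 \<partial>M)"
    unfolding e_def by (intro Bochner_Integration.integral_cong refl) (simp add: init)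
  then have e_0: "e 0 = disagreement X0" by (simp add: prob_space)
  \<comment> \<open>The two step-size rules differ only in the supersolution \<open>s\<close> that is supplied.\<close>
  have bound: "integrable M (\<lambda>\<omega>. disagreement (X k \<omega>)) \<and>
      (\<integral>\<omega>. disagreement (X k \<omega>) \<partial>M) \<le> (1 - \<phi>) ^ k * disagreement X0 + s k"
    if step_size: "\<And>k. \<alpha> k \<le> \<theta>" and "0 \<le> s 0"
      and s: "\<And>k. (1 - 3 / 2 * \<phi>) * s k + vtheta / 2 * (\<alpha> k)\<^sup>2 \<le> s (Suc k)" for k s
  proof
    show "integrable M (\<lambda>\<omega>. disagreement (X k \<omega>))"
      by (rule recursion(1)[OF scc step_size])
    have "e k \<le> (1 - 3 / 2 * \<phi>) ^ k * e 0 + s k"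
      using recursion(2)[OF scc step_size] s \<open>0 \<le> s 0\<close> \<open>3 * \<phi> < 1\<close>
      by (intro recursion_le_supersolution[where b = "\<lambda>k. vtheta / 2 * (\<alpha> k)\<^sup>2"])
         (auto simp: e_def)
    also have "\<dots> \<le> (1 - \<phi>) ^ k * disagreement X0 + s k"
      unfolding e_0 using phi_pos \<open>3 * \<phi> < 1\<close>
      by (intro add_right_mono mult_right_mono power_mono) (auto simp: disagreement_eq)
    finally show "(\<integral>\<omega>. disagreement (X k \<omega>) \<partial>M) \<le> (1 - \<phi>) ^ k * disagreement X0 + s k"
      by (simp add: e_def)
  qed
  have decaying: "integrable M (\<lambda>\<omega>. disagreement (X k \<omega>)) \<and>
      (\<integral>\<omega>. disagreement (X k \<omega>) \<partial>M) \<le> (1 - \<phi>) ^ k * disagreement X0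
        + 2 * \<iota> * vtheta * \<theta>\<^sup>2 / \<phi> * (1 / (real k + k0)\<^sup>2)"
    if alpha: "\<forall>k. \<alpha> k = \<theta> / (real k + k0)" for k
  proof -
    define C where "C = 2 * \<iota> * vtheta * \<theta>\<^sup>2 / \<phi>"
    have "2 < 2 / \<phi>" using phi_pos \<open>3 * \<phi> < 1\<close> by (simp add: pos_less_divide_eq)
    then have "1 < k0" using k0 by simp
    have "1 \<le> (1 + 1 / k0)\<^sup>2" using \<open>1 < k0\<close> by (intro one_le_power) simp
    then have "1 \<le> \<iota>" using iota by simp
    then have "0 \<le> C" using \<open>0 \<le> vtheta\<close> phi_pos by (simp add: C_def)
    have "vtheta * \<theta>\<^sup>2 \<le> \<iota> * (vtheta * \<theta>\<^sup>2)"
      using \<open>1 \<le> \<iota>\<close> \<open>0 \<le> vtheta\<close> mult_right_mono[of 1 \<iota> "vtheta * \<theta>\<^sup>2"] by simp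
    \<comment> \<open>A source below \<open>\<phi> C / 4\<close> turns the rate \<open>1 - 3 \<phi> / 2\<close> into \<open>1 - 5 \<phi> / 4\<close>, still better
      than \<open>1 - \<phi>\<close>.\<close>
    then have source: "vtheta / 2 * \<theta>\<^sup>2 \<le> \<phi> / 4 * C"
      using phi_pos by (simp add: C_def mult.assoc)
    show ?thesis
      unfolding C_def[symmetric]
    proof (rule bound)
      show "\<alpha> k \<le> \<theta>" for k
        using \<open>0 < \<theta>\<close> \<open>1 < k0\<close> by (simp add: alpha pos_divide_le_eq)
      show "0 \<le> C * (1 / (real 0 + k0)\<^sup>2)" using \<open>0 \<le> C\<close> by simp
      fix k
      have t: "2 / \<phi> < real k + k0" using k0 by simp
      have "(1 - 3 / 2 * \<phi>) * (C * (1 / (real k + k0)\<^sup>2)) + vtheta / 2 * (\<alpha> k)\<^sup>2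
          = ((1 - 3 / 2 * \<phi>) * C + vtheta / 2 * \<theta>\<^sup>2) / (real k + k0)\<^sup>2"
        by (simp add: alpha power_divide add_divide_distrib)
      also have "\<dots> \<le> ((1 - \<phi>) * C) / (real k + k0)\<^sup>2"
        using source mult_nonneg_nonneg[OF less_imp_le[OF phi_pos] \<open>0 \<le> C\<close>]
        by (intro divide_right_mono) (simp_all add: algebra_simps)
      also have "\<dots> = C * ((1 - \<phi>) / (real k + k0)\<^sup>2)" by simp
      also have "\<dots> \<le> C * (1 / (real k + k0 + 1)\<^sup>2)"
        using t phi_pos \<open>3 * \<phi> < 1\<close> \<open>0 \<le> C\<close> by (intro mult_left_mono inverse_square_decay_ge) auto
      finally show "(1 - 3 / 2 * \<phi>) * (C * (1 / (real k + k0)\<^sup>2)) + vtheta / 2 * (\<alpha> k)\<^sup>2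
          \<le> C * (1 / (real (Suc k) + k0)\<^sup>2)"
        by (simp add: add.commute add.left_commute)
    qed
  qed
  have constant_step: "integrable M (\<lambda>\<omega>. disagreement (X k \<omega>)) \<and>
      (\<integral>\<omega>. disagreement (X k \<omega>) \<partial>M) \<le> (1 - \<phi>) ^ k * disagreement X0 + vtheta / \<phi> * a\<^sup>2"
    if "0 < a" "a \<le> \<theta>" and alpha: "\<forall>k. \<alpha> k = a" for a k
  proof (rule bound)
    show "\<alpha> k \<le> \<theta>" for k using that by simp
    show "0 \<le> vtheta / \<phi> * a\<^sup>2" using \<open>0 \<le> vtheta\<close> phi_pos by simp
    have "(1 - 3 / 2 * \<phi>) * (vtheta / \<phi> * a\<^sup>2) + vtheta / 2 * a\<^sup>2
        = (1 - \<phi>) * (vtheta / \<phi> * a\<^sup>2)"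
      using phi_pos by (simp add: field_simps)
    also have "\<dots> \<le> vtheta / \<phi> * a\<^sup>2"
      using \<open>0 \<le> vtheta\<close> phi_pos by (intro mult_left_le_one_le) (use \<open>3 * \<phi> < 1\<close> in auto)
    finally show "(1 - 3 / 2 * \<phi>) * (vtheta / \<phi> * a\<^sup>2) + vtheta / 2 * (\<alpha> k)\<^sup>2 \<le> vtheta / \<phi> * a\<^sup>2"
      for k by (simp add: alpha)
  qed
  show ?thesis
    using decaying constant_step by blast
qed

end
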